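(* Let $1<p,q<\infty$ with $\frac1p+\frac1q<1$, and let $(e_i)_i$ and $(f_i)_i$ be the canonical bases of $\ell_p$ and $\ell_q$, respectively. Put $r=\frac{pq}{p+q}>1$. Then the element $$z:=\sum_{i=1}^\infty 2^{-i/r}\,e_i\otimes f_i\in\ell_p\widehat\otimes_\pi\ell_q$$ does not attain its projective norm. In particular, $\mathrm{NA}(\ell_p\widehat\otimes_\pi\ell_q)\neq\ell_p\widehat\otimes_\pi\ell_q$.
   Context: The spaces are over $\mathbb K\in\{\mathbb R,\mathbb C\}$. $X\widehat\otimes_\pi Y$ is the projective tensor product, i.e. the completion of $X\otimes Y$ under $\|z\|_\pi=\inf\{\sum_{i=1}^n\|x_i\|\|y_i\|:z=\sum_{i=1}^nx_i\otimes y_i\}$. An element $z\in X\widehat\otimes_\pi Y$ attains its projective norm if there are sequences $(x_i)$ in $X$, $(y_i)$ in $Y$ with $z=\sum_{i=1}^\infty x_i\otimes y_i$ and $\|z\|_\pi=\sum_{i=1}^\infty\|x_i\|\|y_i\|$. $\mathrm{NA}(X\widehat\otimes_\pi Y)$ is the set of elements attaining their projective norm. *)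

theory Defs
  imports "HOL-Analysis.Analysis" "HOL-Library.Function_Algebras"
begin

section \<open>Normed spaces with an explicit carrier\<close>

text \<open>
  The exponent of \<open>\<ell>\<^sub>p\<close> is a term, so \<open>\<ell>\<^sub>p\<close> cannot be a type and normed spaces are given by a carrier
  set, a scalar multiplication and a norm. Addition is that of the ambient type.
\<close>

record ('k, 'a) nspace =
  vecs :: "'a set"
  scal :: "'k \<Rightarrow> 'a \<Rightarrow> 'a"
  nrm :: "'a \<Rightarrow> real"

definition lp :: "real \<Rightarrow> ('k::real_normed_field, nat \<Rightarrow> 'k) nspace" where
  "lp p = \<lparr>vecs = {x. summable (\<lambda>n. norm (x n) powr p)},
           scal = (\<lambda>c x n. c * x n),
           nrm = (\<lambda>x. (\<Sum>n. norm (x n) powr p) powr (1 / p))\<rparr>"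

text \<open>Indices start at 0: \<open>unit_seq i\<close> is the basis vector usually written with index \<open>i + 1\<close>.\<close>

definition unit_seq :: "nat \<Rightarrow> nat \<Rightarrow> 'k::real_normed_field" where
  "unit_seq i = (\<lambda>n. if n = i then 1 else 0)"

section \<open>The algebraic tensor product\<close>

definition bilinear_on ::
  "('k, 'a::ab_group_add) nspace \<Rightarrow> ('k, 'b::ab_group_add) nspace \<Rightarrow> ('k \<Rightarrow> 'c \<Rightarrow> 'c)
    \<Rightarrow> ('a \<Rightarrow> 'b \<Rightarrow> 'c::ab_group_add) \<Rightarrow> bool" where
  "bilinear_on X Y s B \<longleftrightarrow>
     (\<forall>x\<in>vecs X. \<forall>x'\<in>vecs X. \<forall>y\<in>vecs Y. B (x + x') y = B x y + B x' y) \<and>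
     (\<forall>x\<in>vecs X. \<forall>y\<in>vecs Y. \<forall>y'\<in>vecs Y. B x (y + y') = B x y + B x y') \<and>
     (\<forall>c. \<forall>x\<in>vecs X. \<forall>y\<in>vecs Y. B (scal X c x) y = s c (B x y)) \<and>
     (\<forall>c. \<forall>x\<in>vecs X. \<forall>y\<in>vecs Y. B x (scal Y c y) = s c (B x y))"

text \<open>
  As in Ryan's \<^emph>\<open>Introduction to Tensor Products of Banach Spaces\<close>, \<open>X \<otimes> Y\<close> is the space spanned by the
  evaluations \<open>x \<otimes> y : B \<mapsto> B x y\<close> on the (not necessarily bounded) bilinear forms. The lemma
  \<open>tensor_universal\<close> below shows that no relations hold beyond those forced by bilinearity.
\<close>

type_synonym ('k, 'a, 'b) tens = "('a \<Rightarrow> 'b \<Rightarrow> 'k) \<Rightarrow> 'k"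

definition tensor ::
  "('k::real_normed_field, 'a::ab_group_add) nspace \<Rightarrow> ('k, 'b::ab_group_add) nspace
    \<Rightarrow> 'a \<Rightarrow> 'b \<Rightarrow> ('k, 'a, 'b) tens" where
  "tensor X Y x y = (\<lambda>B. if bilinear_on X Y (*) B then B x y else 0)"

definition tscale :: "'k::real_normed_field \<Rightarrow> ('k, 'a, 'b) tens \<Rightarrow> ('k, 'a, 'b) tens" where
  "tscale c t = (\<lambda>B. c * t B)"

definition tensor_space ::
  "('k::real_normed_field, 'a::ab_group_add) nspace \<Rightarrow> ('k, 'b::ab_group_add) nspace
    \<Rightarrow> ('k, 'a, 'b) tens set" where
  "tensor_space X Y =
     {\<Sum>i<n. tensor X Y (x i) (y i) | (n::nat) x y. (\<forall>i<n. x i \<in> vecs X \<and> y i \<in> vecs Y)}"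

definition proj_norm ::
  "('k::real_normed_field, 'a::ab_group_add) nspace \<Rightarrow> ('k, 'b::ab_group_add) nspace
    \<Rightarrow> ('k, 'a, 'b) tens \<Rightarrow> real" where
  "proj_norm X Y t =
     Inf {\<Sum>i<n. nrm X (x i) * nrm Y (y i) | (n::nat) x y.
            (\<forall>i<n. x i \<in> vecs X \<and> y i \<in> vecs Y) \<and> t = (\<Sum>i<n. tensor X Y (x i) (y i))}"

lemma fun_sum_apply: "(\<Sum>i\<in>A. f i) z = (\<Sum>i\<in>A. f i z)"
  for f :: "'i \<Rightarrow> 'z \<Rightarrow> 'c::comm_monoid_add"
  by (induction A rule: infinite_finite_induct) auto

lemma tensor_universal:
  fixes X :: "('k::real_normed_field, 'a::ab_group_add) nspace"
    and Y :: "('k, 'b::ab_group_add) nspace" and s :: "'k \<Rightarrow> 'c \<Rightarrow> 'c::ab_group_add"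
  assumes vs: "vector_space s" and bil: "bilinear_on X Y s \<Phi>"
    and xy: "\<forall>i<n. x i \<in> vecs X \<and> y i \<in> vecs Y"
    and eq0: "(\<Sum>i<n. tensor X Y (x i) (y i)) = 0"
  shows "(\<Sum>i<n::nat. \<Phi> (x i) (y i)) = 0"
proof (rule ccontr)
  define v where "v = (\<Sum>i<n. \<Phi> (x i) (y i))"
  assume "(\<Sum>i<n. \<Phi> (x i) (y i)) \<noteq> 0"
  then have "v \<noteq> 0" by (simp add: v_def)
  interpret S: vector_space s by (rule vs)
  interpret P: vector_space_pair s "(*) :: 'k \<Rightarrow> 'k \<Rightarrow> 'k"
    by unfold_locales (simp_all add: algebra_simps)
  have "S.independent {v}" using \<open>v \<noteq> 0\<close> S.independent_insert[of v "{}"] by simp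
  then obtain g where g: "Vector_Spaces.linear s (*) g" "g v = 1"
    using P.linear_independent_extend[of "{v}" "\<lambda>_. 1"] by auto
  interpret L: Vector_Spaces.linear s "(*)" g by (rule g)
  define B where "B = (\<lambda>x y. g (\<Phi> x y))"
  have "bilinear_on X Y (*) B"
    using bil by (simp add: bilinear_on_def B_def L.add L.scale)
  then have "(\<Sum>i<n. tensor X Y (x i) (y i)) B = (\<Sum>i<n. B (x i) (y i))"
    by (simp add: fun_sum_apply tensor_def)
  also have "\<dots> = g v" by (simp add: B_def v_def L.sum)
  finally show False using eq0 g by simp
qed

section \<open>Completion\<close>

text \<open>
  Cauchy sequences in \<open>V\<close> modulo null sequences, for a subset \<open>V\<close> of an abelian group carrying a
  (semi)norm \<open>N\<close>.
\<close>

definition cauchy_seqs :: "'v::ab_group_add set \<Rightarrow> ('v \<Rightarrow> real) \<Rightarrow> (nat \<Rightarrow> 'v) set" where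
  "cauchy_seqs V N =
     {u. (\<forall>n. u n \<in> V) \<and> (\<forall>e>0. \<exists>M. \<forall>m\<ge>M. \<forall>n\<ge>M. N (u m - u n) < e)}"

definition null_rel ::
  "'v::ab_group_add set \<Rightarrow> ('v \<Rightarrow> real) \<Rightarrow> ((nat \<Rightarrow> 'v) \<times> (nat \<Rightarrow> 'v)) set" where
  "null_rel V N =
     {(u, w). u \<in> cauchy_seqs V N \<and> w \<in> cauchy_seqs V N \<and> (\<lambda>n. N (u n - w n)) \<longlonglongrightarrow> 0}"

definition completion :: "'v::ab_group_add set \<Rightarrow> ('v \<Rightarrow> real) \<Rightarrow> (nat \<Rightarrow> 'v) set set" where
  "completion V N = cauchy_seqs V N // null_rel V N"

definition completion_embed ::
  "'v::ab_group_add set \<Rightarrow> ('v \<Rightarrow> real) \<Rightarrow> 'v \<Rightarrow> (nat \<Rightarrow> 'v) set" where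
  "completion_embed V N v = null_rel V N `` {\<lambda>_. v}"

definition completion_norm :: "('v::ab_group_add \<Rightarrow> real) \<Rightarrow> (nat \<Rightarrow> 'v) set \<Rightarrow> real" where
  "completion_norm N z = (THE l. \<forall>u\<in>z. (\<lambda>n. N (u n)) \<longlonglongrightarrow> l)"

definition completion_dist ::
  "('v::ab_group_add \<Rightarrow> real) \<Rightarrow> (nat \<Rightarrow> 'v) set \<Rightarrow> (nat \<Rightarrow> 'v) set \<Rightarrow> real" where
  "completion_dist N z z' = (THE l. \<forall>u\<in>z. \<forall>w\<in>z'. (\<lambda>n. N (u n - w n)) \<longlonglongrightarrow> l)"

section \<open>The projective tensor product\<close>

definition proj_tensor ::
  "('k::real_normed_field, 'a::ab_group_add) nspace \<Rightarrow> ('k, 'b::ab_group_add) nspace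
    \<Rightarrow> (nat \<Rightarrow> ('k, 'a, 'b) tens) set set" where
  "proj_tensor X Y = completion (tensor_space X Y) (proj_norm X Y)"

definition tens_sums ::
  "('k::real_normed_field, 'a::ab_group_add) nspace \<Rightarrow> ('k, 'b::ab_group_add) nspace
    \<Rightarrow> (nat \<Rightarrow> ('k, 'a, 'b) tens) \<Rightarrow> (nat \<Rightarrow> ('k, 'a, 'b) tens) set \<Rightarrow> bool" where
  "tens_sums X Y t z \<longleftrightarrow>
     z \<in> proj_tensor X Y \<and>
     (\<lambda>n. completion_dist (proj_norm X Y)
        (completion_embed (tensor_space X Y) (proj_norm X Y) (\<Sum>i<n. t i)) z) \<longlonglongrightarrow> 0"

definition tens_suminf ::
  "('k::real_normed_field, 'a::ab_group_add) nspace \<Rightarrow> ('k, 'b::ab_group_add) nspace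
    \<Rightarrow> (nat \<Rightarrow> ('k, 'a, 'b) tens) \<Rightarrow> (nat \<Rightarrow> ('k, 'a, 'b) tens) set" where
  "tens_suminf X Y t = (THE z. tens_sums X Y t z)"

definition attains_proj_norm ::
  "('k::real_normed_field, 'a::ab_group_add) nspace \<Rightarrow> ('k, 'b::ab_group_add) nspace
    \<Rightarrow> (nat \<Rightarrow> ('k, 'a, 'b) tens) set \<Rightarrow> bool" where
  "attains_proj_norm X Y z \<longleftrightarrow>
     (\<exists>x y. (\<forall>i::nat. x i \<in> vecs X \<and> y i \<in> vecs Y) \<and>
            tens_sums X Y (\<lambda>i. tensor X Y (x i) (y i)) z \<and>
            (\<lambda>i. nrm X (x i) * nrm Y (y i)) sums completion_norm (proj_norm X Y) z)"

definition NA ::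
  "('k::real_normed_field, 'a::ab_group_add) nspace \<Rightarrow> ('k, 'b::ab_group_add) nspace
    \<Rightarrow> (nat \<Rightarrow> ('k, 'a, 'b) tens) set set" where
  "NA X Y = {z \<in> proj_tensor X Y. attains_proj_norm X Y z}"

text \<open>The \<open>i\<close>-th term of the series, with the index shifted because sequences start at 0.\<close>

definition zterm :: "real \<Rightarrow> real \<Rightarrow> real \<Rightarrow> nat
    \<Rightarrow> ('k::real_normed_field, nat \<Rightarrow> 'k, nat \<Rightarrow> 'k) tens" where
  "zterm p q r i =
     tscale (of_real (2 powr (- real (Suc i) / r))) (tensor (lp p) (lp q) (unit_seq i) (unit_seq i))"

end

(*
  The diagonal of the projective tensor product is isometric to l_r: averaging rank-one tensors over
  all sign patterns shows that z has norm at most 1, and Hoelder's inequality for the exponents p, q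
  and r' gives a norm-one bilinear form taking the value 1 at z. If z were a norm-attaining sum of
  x_i (x) y_i, every term would be extremal in Hoelder's inequality, so after rescaling coordinates
  each x_i has constant modulus and y_i is a multiple of its conjugate. Vanishing of the off-diagonal
  coordinates of z then makes the coordinates of the x_i an infinite orthonormal sequence in an atomic
  L^2-space that does not tend to 0 at an atom, contradicting Bessel's inequality.
*)

theory Submission
  imports Defs
begin

text \<open>Everything is governed by the probability weights
  \<open>w n = 2 powr - real (Suc n)\<close>. As \<open>1 / r = 1 / p + 1 / q\<close>, the
  coefficients of z are \<open>w n powr (1 / p) * w n powr (1 / q)\<close>. The weight of the
  bilinear form is \<open>w n powr \<gamma>\<close> with
  \<open>\<gamma> = 1 - 1 / p - 1 / q\<close>, the reciprocal of r', which is positive precisely by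
  the hypothesis on p and q; the three powers multiply to \<open>w n\<close>, whence the value 1 at
  z. Dividing the coordinates of x_i and y_i by \<open>w n powr (1 / p)\<close> and
  \<open>w n powr (1 / q)\<close> turns the diagonal of z into the identity matrix, and this is the
  source of orthonormality. The obstacle is that z is a class of Cauchy sequences, so a
  representation of z has no coordinates to compare directly. It is tested only against contractive
  bilinear forms: the coordinate products and the weighted form. Terms whose norm product is 0 say
  nothing about equality in Hoelder's inequality and need a separate argument.\<close>

section \<open>Completion of a seminormed group\<close>

text \<open>The axioms are relative to \<open>V\<close> because the intended \<open>N\<close> is
  \<open>proj_norm\<close>, which outside \<open>tensor_space\<close> is the infimum of an empty
  set.\<close>

locale seminormed_group =
  fixes V :: "'v::ab_group_add set" and N :: "'v \<Rightarrow> real"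
  assumes zero_mem: "0 \<in> V"
    and diff_mem: "a \<in> V \<Longrightarrow> b \<in> V \<Longrightarrow> a - b \<in> V"
    and N_zero: "N 0 = 0"
    and N_nonneg: "a \<in> V \<Longrightarrow> 0 \<le> N a"
    and N_minus: "a \<in> V \<Longrightarrow> N (- a) = N a"
    and N_add: "a \<in> V \<Longrightarrow> b \<in> V \<Longrightarrow> N (a + b) \<le> N a + N b"
begin

lemma add_mem: "a \<in> V \<Longrightarrow> b \<in> V \<Longrightarrow> a + b \<in> V"
  using diff_mem[OF _ diff_mem[OF zero_mem], of a b] by simp

lemma sum_mem: "(\<And>i. i \<in> A \<Longrightarrow> f i \<in> V) \<Longrightarrow> (\<Sum>i\<in>A. f i) \<in> V"
  by (induction A rule: infinite_finite_induct) (auto simp: zero_mem add_mem)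

lemma N_sum_le: "(\<And>i. i \<in> A \<Longrightarrow> f i \<in> V) \<Longrightarrow> N (\<Sum>i\<in>A. f i) \<le> (\<Sum>i\<in>A. N (f i))"
proof (induction A rule: infinite_finite_induct)
  case (insert x F)
  then have "N (\<Sum>i\<in>insert x F. f i) \<le> N (f x) + N (\<Sum>i\<in>F. f i)"
    by (simp add: N_add sum_mem)
  then show ?case using insert by fastforce
qed (auto simp: N_zero)

lemma N_commute: "a \<in> V \<Longrightarrow> b \<in> V \<Longrightarrow> N (a - b) = N (b - a)"
  using N_minus[of "a - b"] diff_mem by simp

lemma N_triangle: "a \<in> V \<Longrightarrow> b \<in> V \<Longrightarrow> c \<in> V \<Longrightarrow> N (a - c) \<le> N (a - b) + N (b - c)"
  using N_add[of "a - b" "b - c"] diff_mem by simp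

text \<open>Quadrilateral inequality: it yields both the convergence of distances between Cauchy
  sequences and their independence of representatives.\<close>

lemma N_quad:
  assumes "a \<in> V" "b \<in> V" "c \<in> V" "d \<in> V"
  shows "\<bar>N (a - b) - N (c - d)\<bar> \<le> N (a - c) + N (b - d)"
proof -
  have "N (a - b) \<le> N (a - c) + (N (c - d) + N (d - b))"
    using N_triangle[of a c b] N_triangle[of c d b] assms by simp
  moreover have "N (c - d) \<le> N (c - a) + (N (a - b) + N (b - d))"
    using N_triangle[of c a d] N_triangle[of a b d] assms by simp
  ultimately show ?thesis using N_commute[of d b] N_commute[of c a] assms by simp
qed

lemma cauchy_mem: "u \<in> cauchy_seqs V N \<Longrightarrow> u n \<in> V"
  by (simp add: cauchy_seqs_def)

lemma const_cauchy: "v \<in> V \<Longrightarrow> (\<lambda>_. v) \<in> cauchy_seqs V N"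
  by (simp add: cauchy_seqs_def N_zero)

lemma dist_convergent:
  assumes u: "u \<in> cauchy_seqs V N" and w: "w \<in> cauchy_seqs V N"
  shows "convergent (\<lambda>n. N (u n - w n))"
proof -
  have "Cauchy (\<lambda>n. N (u n - w n))"
  proof (rule metric_CauchyI)
    fix e :: real assume "e > 0"
    then have "e / 2 > 0" by simp
    obtain M1 where M1: "\<forall>m\<ge>M1. \<forall>n\<ge>M1. N (u m - u n) < e / 2"
      using u \<open>e / 2 > 0\<close> unfolding cauchy_seqs_def by blast
    obtain M2 where M2: "\<forall>m\<ge>M2. \<forall>n\<ge>M2. N (w m - w n) < e / 2"
      using w \<open>e / 2 > 0\<close> unfolding cauchy_seqs_def by blast
    have "dist (N (u m - w m)) (N (u n - w n)) < e"
      if "m \<ge> max M1 M2" "n \<ge> max M1 M2" for m n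
    proof -
      have "N (u m - u n) < e / 2" "N (w m - w n) < e / 2" using M1 M2 that by auto
      then show ?thesis
        using N_quad[of "u m" "w m" "u n" "w n"] cauchy_mem[OF u] cauchy_mem[OF w]
        by (simp add: dist_real_def)
    qed
    then show "\<exists>M. \<forall>m\<ge>M. \<forall>n\<ge>M. dist (N (u m - w m)) (N (u n - w n)) < e" by blast
  qed
  then show ?thesis by (simp add: real_Cauchy_convergent)
qed

text \<open>Independence of representatives, as required by the definite descriptions in
  \<open>completion_norm\<close> and \<open>completion_dist\<close>.\<close>

lemma dist_limit_cong:
  assumes "(u, u') \<in> null_rel V N" "(w, w') \<in> null_rel V N"
    and lim: "(\<lambda>n. N (u n - w n)) \<longlonglongrightarrow> l"
  shows "(\<lambda>n. N (u' n - w' n)) \<longlonglongrightarrow> l"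
proof -
  have mem: "u n \<in> V" "u' n \<in> V" "w n \<in> V" "w' n \<in> V" for n
    using assms by (auto simp: null_rel_def cauchy_mem)
  have "(\<lambda>n. N (u n - u' n) + N (w n - w' n)) \<longlonglongrightarrow> 0 + 0"
    using assms by (intro tendsto_add) (auto simp: null_rel_def)
  then have bound: "(\<lambda>n. N (u n - u' n) + N (w n - w' n)) \<longlonglongrightarrow> 0" by simp
  have "norm (N (u n - w n) - N (u' n - w' n)) \<le> N (u n - u' n) + N (w n - w' n)" for n
    unfolding real_norm_def by (rule N_quad[OF mem(1,3,2,4)])
  then have "(\<lambda>n. N (u n - w n) - N (u' n - w' n)) \<longlonglongrightarrow> 0"
    by (intro Lim_null_comparison[OF always_eventually bound] allI)
  from tendsto_diff[OF lim this] show ?thesis by simp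
qed

lemma null_rel_equiv: "equiv (cauchy_seqs V N) (null_rel V N)"
proof (rule equivI)
  show "null_rel V N \<subseteq> cauchy_seqs V N \<times> cauchy_seqs V N"
    by (auto simp: null_rel_def)
  show "refl_on (cauchy_seqs V N) (null_rel V N)"
    by (auto simp: refl_on_def null_rel_def N_zero)
  show sym: "sym (null_rel V N)"
    by (auto simp: sym_def null_rel_def N_commute cauchy_mem)
  show "trans (null_rel V N)"
  proof (rule transI)
    fix u v w assume uv: "(u, v) \<in> null_rel V N" and vw: "(v, w) \<in> null_rel V N"
    have "(v, u) \<in> null_rel V N" using sym uv by (auto dest: symD)
    moreover have "(\<lambda>n. N (v n - v n)) \<longlonglongrightarrow> 0" by (simp add: N_zero)
    \<comment> \<open>The null sequence \<open>N (v n - v n)\<close> is transported from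
      \<open>v\<close> to \<open>u\<close> on the left and from \<open>v\<close> to \<open>w\<close>
      on the right.\<close>
    ultimately have "(\<lambda>n. N (u n - w n)) \<longlonglongrightarrow> 0"
      by (rule dist_limit_cong[OF _ vw])
    then show "(u, w) \<in> null_rel V N" using uv vw by (auto simp: null_rel_def)
  qed
qed

lemma completion_nonempty: "z \<in> completion V N \<Longrightarrow> \<exists>u. u \<in> z"
  unfolding completion_def by (drule in_quotient_imp_non_empty[OF null_rel_equiv]) auto

lemma completion_cauchy: "z \<in> completion V N \<Longrightarrow> u \<in> z \<Longrightarrow> u \<in> cauchy_seqs V N"
  unfolding completion_def by (drule in_quotient_imp_subset[OF null_rel_equiv]) auto

lemma completion_rel: "z \<in> completion V N \<Longrightarrow> u \<in> z \<Longrightarrow> w \<in> z \<Longrightarrow> (u, w) \<in> null_rel V N"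
  unfolding completion_def by (rule in_quotient_imp_in_rel[OF null_rel_equiv]) auto

lemma completion_dist_lim:
  assumes z: "z \<in> completion V N" "z' \<in> completion V N" and uw: "u \<in> z" "w \<in> z'"
  shows "(\<lambda>n. N (u n - w n)) \<longlonglongrightarrow> completion_dist N z z'"
proof -
  obtain l where l: "(\<lambda>n. N (u n - w n)) \<longlonglongrightarrow> l"
    using dist_convergent completion_cauchy z uw unfolding convergent_def by blast
  have "completion_dist N z z' = l" unfolding completion_dist_def
  proof (rule the_equality)
    show "\<forall>u\<in>z. \<forall>w\<in>z'. (\<lambda>n. N (u n - w n)) \<longlonglongrightarrow> l"
      using dist_limit_cong[OF completion_rel completion_rel l] z uw by blast
    show "\<And>l'. \<forall>u\<in>z. \<forall>w\<in>z'. (\<lambda>n. N (u n - w n)) \<longlonglongrightarrow> l' \<Longrightarrow> l' = l"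
      using l uw by (auto intro: LIMSEQ_unique)
  qed
  then show ?thesis using l by simp
qed

lemma completion_norm_lim:
  assumes z: "z \<in> completion V N" and u: "u \<in> z"
  shows "(\<lambda>n. N (u n)) \<longlonglongrightarrow> completion_norm N z"
proof -
  \<comment> \<open>The norm is handled as the distance to the constant sequence 0.\<close>
  have null: "((\<lambda>_. 0), (\<lambda>_. 0)) \<in> null_rel V N"
    using const_cauchy[OF zero_mem] by (simp add: null_rel_def N_zero)
  obtain l where l: "(\<lambda>n. N (u n - 0)) \<longlonglongrightarrow> l"
    using dist_convergent[OF completion_cauchy[OF z u] const_cauchy[OF zero_mem]]
    unfolding convergent_def by blast
  have "completion_norm N z = l" unfolding completion_norm_def
  proof (rule the_equality)
    show "\<forall>u\<in>z. (\<lambda>n. N (u n)) \<longlonglongrightarrow> l"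
      using dist_limit_cong[OF completion_rel[OF z u] null l] by simp
    show "\<And>l'. \<forall>u\<in>z. (\<lambda>n. N (u n)) \<longlonglongrightarrow> l' \<Longrightarrow> l' = l"
      using l u by (auto intro: LIMSEQ_unique)
  qed
  then show ?thesis using l by simp
qed

lemma embed_mem: "v \<in> V \<Longrightarrow> completion_embed V N v \<in> completion V N"
  unfolding completion_def completion_embed_def by (rule quotientI[OF const_cauchy])

lemma const_in_embed: "v \<in> V \<Longrightarrow> (\<lambda>_. v) \<in> completion_embed V N v"
  using const_cauchy[of v] by (simp add: completion_embed_def null_rel_def N_zero)

lemma embed_dist_lim:
  assumes "v \<in> V" "z \<in> completion V N" "u \<in> z"
  shows "(\<lambda>n. N (v - u n)) \<longlonglongrightarrow> completion_dist N (completion_embed V N v) z"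
  using completion_dist_lim[OF embed_mem[OF assms(1)] assms(2) const_in_embed[OF assms(1)] assms(3)]
  by simp

text \<open>Justifies the definite description in \<open>tens_suminf\<close>. The distance of two
  representatives is at most \<open>d n + d' n\<close> for each fixed \<open>n\<close>, and only
  then does \<open>n\<close> tend to infinity.\<close>

lemma limit_unique:
  assumes z: "z \<in> completion V N" "z' \<in> completion V N" and S: "\<And>n. S n \<in> V"
    and lim: "(\<lambda>n. completion_dist N (completion_embed V N (S n)) z) \<longlonglongrightarrow> 0"
      "(\<lambda>n. completion_dist N (completion_embed V N (S n)) z') \<longlonglongrightarrow> 0"
  shows "z = z'"
proof -
  obtain u w where uw: "u \<in> z" "w \<in> z'" using z completion_nonempty by blast
  note c = completion_cauchy[OF z(1) uw(1)] completion_cauchy[OF z(2) uw(2)]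
  define d where "d n = completion_dist N (completion_embed V N (S n)) z" for n
  define d' where "d' n = completion_dist N (completion_embed V N (S n)) z'" for n
  obtain l where l: "(\<lambda>n. N (u n - w n)) \<longlonglongrightarrow> l"
    using dist_convergent[OF c] unfolding convergent_def by blast
  have "l \<le> d n + d' n" for n
  proof (rule LIMSEQ_le[OF l tendsto_add])
    show "(\<lambda>m. N (S n - u m)) \<longlonglongrightarrow> d n" "(\<lambda>m. N (S n - w m)) \<longlonglongrightarrow> d' n"
      unfolding d_def d'_def using S z uw by (auto intro: embed_dist_lim)
    have "N (u m - w m) \<le> N (S n - u m) + N (S n - w m)" for m
      using N_triangle[of "u m" "S n" "w m"] N_commute[of "u m" "S n"] S c by (simp add: cauchy_mem)
    then show "\<exists>k. \<forall>m\<ge>k. N (u m - w m) \<le> N (S n - u m) + N (S n - w m)" by blast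
  qed
  then have "l \<le> 0 + 0"
    using tendsto_add[OF lim] unfolding d_def d'_def
    by (intro LIMSEQ_le_const) auto
  moreover have "l \<ge> 0"
    using LIMSEQ_le_const[OF l] N_nonneg diff_mem c by (simp add: cauchy_mem)
  ultimately have "(u, w) \<in> null_rel V N" using l c by (simp add: null_rel_def)
  then show ?thesis
    using quotient_eqI[OF null_rel_equiv _ _ uw] z unfolding completion_def by simp
qed

text \<open>Pulls equality of two limits back to the uncompleted space, where bilinear forms can be
  evaluated.\<close>

lemma same_limit:
  assumes z: "z \<in> completion V N" and S: "\<And>n. S n \<in> V" "\<And>n. S' n \<in> V"
    and lim: "(\<lambda>n. completion_dist N (completion_embed V N (S n)) z) \<longlonglongrightarrow> 0"
      "(\<lambda>n. completion_dist N (completion_embed V N (S' n)) z) \<longlonglongrightarrow> 0"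
  shows "(\<lambda>n. N (S n - S' n)) \<longlonglongrightarrow> 0"
proof -
  obtain u where u: "u \<in> z" using z completion_nonempty by blast
  note c = completion_cauchy[OF z u]
  have "N (S n - S' n) \<le> completion_dist N (completion_embed V N (S n)) z
      + completion_dist N (completion_embed V N (S' n)) z" for n
  proof (rule LIMSEQ_le[OF tendsto_const tendsto_add])
    show "(\<lambda>m. N (S n - u m)) \<longlonglongrightarrow> completion_dist N (completion_embed V N (S n)) z"
      "(\<lambda>m. N (S' n - u m)) \<longlonglongrightarrow> completion_dist N (completion_embed V N (S' n)) z"
      using S z u by (auto intro: embed_dist_lim)
    have "N (S n - S' n) \<le> N (S n - u m) + N (S' n - u m)" for m
      using N_triangle[of "S n" "u m" "S' n"] N_commute[of "u m" "S' n"] S c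
      by (simp add: cauchy_mem)
    then show "\<exists>k. \<forall>m\<ge>k. N (S n - S' n) \<le> N (S n - u m) + N (S' n - u m)" by blast
  qed
  then have "norm (N (S n - S' n)) \<le> completion_dist N (completion_embed V N (S n)) z
      + completion_dist N (completion_embed V N (S' n)) z" for n
    using N_nonneg[OF diff_mem[OF S(1)[of n] S(2)[of n]]] by simp
  moreover have "(\<lambda>n. completion_dist N (completion_embed V N (S n)) z
      + completion_dist N (completion_embed V N (S' n)) z) \<longlonglongrightarrow> 0"
    using tendsto_add[OF lim] by simp
  ultimately show ?thesis
    by (rule Lim_null_comparison[OF always_eventually, rule_format])
qed

text \<open>A Cauchy sequence converges to its own class; this is the completeness behind the
  summation of series.\<close>

lemma cauchy_embed_lim:
  assumes u: "u \<in> cauchy_seqs V N"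
  defines "z \<equiv> null_rel V N `` {u}"
  shows "z \<in> completion V N" and "u \<in> z"
    and "(\<lambda>n. completion_dist N (completion_embed V N (u n)) z) \<longlonglongrightarrow> 0"
proof -
  show z: "z \<in> completion V N" unfolding z_def completion_def by (rule quotientI[OF u])
  show uz: "u \<in> z" unfolding z_def by (rule equiv_class_self[OF null_rel_equiv u])
  show "(\<lambda>n. completion_dist N (completion_embed V N (u n)) z) \<longlonglongrightarrow> 0"
  proof (rule LIMSEQ_I)
    fix e :: real assume "e > 0"
    then have "e / 2 > 0" by simp
    then obtain M where M: "\<forall>m\<ge>M. \<forall>n\<ge>M. N (u m - u n) < e / 2"
      using u unfolding cauchy_seqs_def by blast
    have "norm (completion_dist N (completion_embed V N (u n)) z - 0) < e" if n: "n \<ge> M" for n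
    proof -
      note lim = embed_dist_lim[OF cauchy_mem[OF u] z uz, of n]
      have "completion_dist N (completion_embed V N (u n)) z \<le> e / 2"
        using M n by (intro LIMSEQ_le_const2[OF lim]) (auto intro!: exI[of _ M] less_imp_le)
      moreover have "completion_dist N (completion_embed V N (u n)) z \<ge> 0"
        using u by (intro LIMSEQ_le_const[OF lim]) (auto intro!: N_nonneg diff_mem simp: cauchy_mem)
      ultimately show ?thesis using \<open>e > 0\<close> by simp
    qed
    then show "\<exists>M. \<forall>n\<ge>M. norm (completion_dist N (completion_embed V N (u n)) z - 0) < e" by blast
  qed
qed

end

section \<open>The projective seminorm\<close>

text \<open>The sign of a tensor is carried by its first factor, so the axioms on negation concern
  \<open>X\<close> alone.\<close>

locale nspace_pair =
  fixes X :: "('k::real_normed_field, 'a::ab_group_add) nspace"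
    and Y :: "('k, 'b::ab_group_add) nspace"
  assumes scal_minus_one: "x \<in> vecs X \<Longrightarrow> scal X (- 1) x = - x"
    and uminus_mem: "x \<in> vecs X \<Longrightarrow> - x \<in> vecs X"
    and nrm_uminus: "x \<in> vecs X \<Longrightarrow> nrm X (- x) = nrm X x"
    and nrm_nonneg: "0 \<le> nrm X x" "0 \<le> nrm Y y"
begin

lemma tensor_uminus:
  assumes "x \<in> vecs X" "y \<in> vecs Y"
  shows "tensor X Y (- x) y = - tensor X Y x y"
proof
  fix B
  have "B (- x) y = - B x y" if "bilinear_on X Y (*) B"
  proof -
    have "B (scal X (- 1) x) y = (- 1) * B x y"
      using that assms unfolding bilinear_on_def by blast
    then show ?thesis by (simp add: scal_minus_one assms)
  qed
  then show "tensor X Y (- x) y B = (- tensor X Y x y) B" by (simp add: tensor_def)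
qed

text \<open>Representations are defined over initial segments of the naturals, while sums below also
  run over disjoint unions and power sets.\<close>

lemma finite_sum_reindex:
  assumes "finite A" and "\<And>i. i \<in> A \<Longrightarrow> x i \<in> vecs X \<and> y i \<in> vecs Y"
  obtains n :: nat and x' y' where "\<forall>i<n. x' i \<in> vecs X \<and> y' i \<in> vecs Y"
    and "(\<Sum>i\<in>A. tensor X Y (x i) (y i)) = (\<Sum>i<n. tensor X Y (x' i) (y' i))"
    and "(\<Sum>i\<in>A. nrm X (x i) * nrm Y (y i)) = (\<Sum>i<n. nrm X (x' i) * nrm Y (y' i))"
proof -
  obtain h where h: "bij_betw h {0..<card A} A" using ex_bij_betw_nat_finite assms(1) by blast
  then have h': "bij_betw h {..<card A} A" by (simp add: atLeast0LessThan)
  show thesis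
  proof (rule that[of "card A" "x \<circ> h" "y \<circ> h"])
    show "\<forall>i<card A. (x \<circ> h) i \<in> vecs X \<and> (y \<circ> h) i \<in> vecs Y"
      using assms(2) bij_betwE[OF h'] by simp
  qed (simp_all add: sum.reindex_bij_betw[OF h', symmetric])
qed

lemma sum_tensor_mem:
  assumes "finite A" and "\<And>i. i \<in> A \<Longrightarrow> x i \<in> vecs X \<and> y i \<in> vecs Y"
  shows "(\<Sum>i\<in>A. tensor X Y (x i) (y i)) \<in> tensor_space X Y"
  by (rule finite_sum_reindex[OF assms]) (auto simp: tensor_space_def)

lemma proj_norm_bdd_below:
  "bdd_below {\<Sum>i<n. nrm X (x i) * nrm Y (y i) | (n::nat) x y.
     (\<forall>i<n. x i \<in> vecs X \<and> y i \<in> vecs Y) \<and> t = (\<Sum>i<n. tensor X Y (x i) (y i))}"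
  by (rule bdd_belowI[of _ 0]) (auto intro!: sum_nonneg mult_nonneg_nonneg nrm_nonneg)

lemma proj_norm_le:
  assumes "finite A" and "\<And>i. i \<in> A \<Longrightarrow> x i \<in> vecs X \<and> y i \<in> vecs Y"
  shows "proj_norm X Y (\<Sum>i\<in>A. tensor X Y (x i) (y i)) \<le> (\<Sum>i\<in>A. nrm X (x i) * nrm Y (y i))"
proof (rule finite_sum_reindex[OF assms])
  fix n :: nat and x' y'
  assume *: "\<forall>i<n. x' i \<in> vecs X \<and> y' i \<in> vecs Y"
    "(\<Sum>i\<in>A. tensor X Y (x i) (y i)) = (\<Sum>i<n. tensor X Y (x' i) (y' i))"
    "(\<Sum>i\<in>A. nrm X (x i) * nrm Y (y i)) = (\<Sum>i<n. nrm X (x' i) * nrm Y (y' i))"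
  show "proj_norm X Y (\<Sum>i\<in>A. tensor X Y (x i) (y i)) \<le> (\<Sum>i\<in>A. nrm X (x i) * nrm Y (y i))"
    unfolding *(2,3) proj_norm_def by (rule cInf_lower[OF _ proj_norm_bdd_below]) (use *(1) in blast)
qed

lemma proj_norm_approx:
  assumes t: "t \<in> tensor_space X Y" and "e > 0"
  obtains n :: nat and x y where "\<forall>i<n. x i \<in> vecs X \<and> y i \<in> vecs Y"
    and "t = (\<Sum>i<n. tensor X Y (x i) (y i))"
    and "(\<Sum>i<n. nrm X (x i) * nrm Y (y i)) < proj_norm X Y t + e"
proof -
  let ?S = "{\<Sum>i<n. nrm X (x i) * nrm Y (y i) | (n::nat) x y.
     (\<forall>i<n. x i \<in> vecs X \<and> y i \<in> vecs Y) \<and> t = (\<Sum>i<n. tensor X Y (x i) (y i))}"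
  have "?S \<noteq> {}" using t unfolding tensor_space_def by blast
  moreover have "Inf ?S < proj_norm X Y t + e" using \<open>e > 0\<close> by (simp add: proj_norm_def)
  ultimately have "\<exists>s\<in>?S. s < proj_norm X Y t + e" by (rule cInf_lessD)
  then obtain s where "s \<in> ?S" and less: "s < proj_norm X Y t + e" ..
  then obtain n :: nat and x y where "s = (\<Sum>i<n. nrm X (x i) * nrm Y (y i))"
      "\<forall>i<n. x i \<in> vecs X \<and> y i \<in> vecs Y" "t = (\<Sum>i<n. tensor X Y (x i) (y i))"
    by blast
  then show thesis using that[of n x y] less by simp
qed

lemma proj_norm_nonneg:
  assumes "t \<in> tensor_space X Y"
  shows "0 \<le> proj_norm X Y t"
proof (rule field_le_epsilon)
  fix e :: real assume "e > 0"
  obtain n :: nat and x y where "\<forall>i<n. x i \<in> vecs X \<and> y i \<in> vecs Y"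
      "t = (\<Sum>i<n. tensor X Y (x i) (y i))"
      "(\<Sum>i<n. nrm X (x i) * nrm Y (y i)) < proj_norm X Y t + e"
    by (rule proj_norm_approx[OF assms \<open>e > 0\<close>])
  moreover have "0 \<le> (\<Sum>i<n. nrm X (x i) * nrm Y (y i))"
    by (intro sum_nonneg mult_nonneg_nonneg nrm_nonneg)
  ultimately show "0 \<le> proj_norm X Y t + e" by simp
qed

lemma tensor_space_add:
  assumes s: "s \<in> tensor_space X Y" and t: "t \<in> tensor_space X Y"
  shows "s + t \<in> tensor_space X Y"
    and "proj_norm X Y (s + t) \<le> proj_norm X Y s + proj_norm X Y t"
proof -
  have main: "s + t \<in> tensor_space X Y \<and>
    proj_norm X Y (s + t) \<le> proj_norm X Y s + proj_norm X Y t + e" if "e > 0" for e :: real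
  proof -
    from that have "e / 2 > 0" by simp
    obtain n :: nat and x y where 1: "\<forall>i<n. x i \<in> vecs X \<and> y i \<in> vecs Y"
        "s = (\<Sum>i<n. tensor X Y (x i) (y i))"
        "(\<Sum>i<n. nrm X (x i) * nrm Y (y i)) < proj_norm X Y s + e / 2"
      by (rule proj_norm_approx[OF s \<open>e / 2 > 0\<close>])
    obtain m :: nat and u v where 2: "\<forall>i<m. u i \<in> vecs X \<and> v i \<in> vecs Y"
        "t = (\<Sum>i<m. tensor X Y (u i) (v i))"
        "(\<Sum>i<m. nrm X (u i) * nrm Y (v i)) < proj_norm X Y t + e / 2"
      by (rule proj_norm_approx[OF t \<open>e / 2 > 0\<close>])
    \<comment> \<open>Two almost optimal representations are concatenated; this gives closure under
      addition and the triangle inequality up to \<open>e\<close>.\<close>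
    let ?A = "{..<n} <+> {..<m}" and ?x = "case_sum x u" and ?y = "case_sum y v"
    have fin: "finite ?A" by simp
    have mem: "\<And>i. i \<in> ?A \<Longrightarrow> ?x i \<in> vecs X \<and> ?y i \<in> vecs Y" using 1 2 by auto
    have "s + t = (\<Sum>i\<in>?A. tensor X Y (?x i) (?y i))" using 1 2 by (simp add: sum.Plus)
    moreover have "(\<Sum>i\<in>?A. nrm X (?x i) * nrm Y (?y i))
        = (\<Sum>i<n. nrm X (x i) * nrm Y (y i)) + (\<Sum>i<m. nrm X (u i) * nrm Y (v i))"
      by (simp add: sum.Plus)
    ultimately show ?thesis
      using sum_tensor_mem[OF fin, of ?x ?y] proj_norm_le[OF fin, of ?x ?y] mem 1(3) 2(3) by simp
  qed
  show "s + t \<in> tensor_space X Y" using main[of 1] by simp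
  show "proj_norm X Y (s + t) \<le> proj_norm X Y s + proj_norm X Y t"
    by (rule field_le_epsilon) (use main in blast)
qed

lemma tensor_space_uminus:
  assumes t: "t \<in> tensor_space X Y"
  shows "- t \<in> tensor_space X Y" and "proj_norm X Y (- t) \<le> proj_norm X Y t"
proof -
  have main: "- t \<in> tensor_space X Y \<and> proj_norm X Y (- t) \<le> proj_norm X Y t + e"
    if "e > 0" for e :: real
  proof -
    obtain n :: nat and x y where 1: "\<forall>i<n. x i \<in> vecs X \<and> y i \<in> vecs Y"
        "t = (\<Sum>i<n. tensor X Y (x i) (y i))"
        "(\<Sum>i<n. nrm X (x i) * nrm Y (y i)) < proj_norm X Y t + e"
      by (rule proj_norm_approx[OF t \<open>e > 0\<close>])
    have eq: "- t = (\<Sum>i<n. tensor X Y (- x i) (y i))"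
      unfolding 1(2) sum_negf[symmetric] using 1(1) by (intro sum.cong) (auto simp: tensor_uminus)
    have nrm: "(\<Sum>i<n. nrm X (- x i) * nrm Y (y i)) = (\<Sum>i<n. nrm X (x i) * nrm Y (y i))"
      using 1(1) by (intro sum.cong) (auto simp: nrm_uminus)
    have mem: "\<And>i. i \<in> {..<n} \<Longrightarrow> - x i \<in> vecs X \<and> y i \<in> vecs Y" using 1(1) uminus_mem by auto
    show ?thesis
      using sum_tensor_mem[of "{..<n}" "\<lambda>i. - x i" y] proj_norm_le[of "{..<n}" "\<lambda>i. - x i" y] mem 1(3)
      unfolding eq[symmetric] nrm by simp
  qed
  show "- t \<in> tensor_space X Y" using main[of 1] by simp
  show "proj_norm X Y (- t) \<le> proj_norm X Y t" by (rule field_le_epsilon) (use main in blast)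
qed

lemma zero_in_tensor_space: "0 \<in> tensor_space X Y"
  using sum_tensor_mem[of "{}"] by simp

sublocale seminormed_group "tensor_space X Y" "proj_norm X Y"
proof
  show "proj_norm X Y 0 = 0"
    using proj_norm_le[of "{}"] proj_norm_nonneg[OF zero_in_tensor_space] by simp
  show "a - b \<in> tensor_space X Y" if "a \<in> tensor_space X Y" "b \<in> tensor_space X Y" for a b
    using tensor_space_add(1)[of a "- b"] tensor_space_uminus(1)[of b] that by simp
  show "proj_norm X Y (- a) = proj_norm X Y a" if "a \<in> tensor_space X Y" for a
    using tensor_space_uminus[of a] tensor_space_uminus(2)[of "- a"] that by simp
qed (simp_all add: zero_in_tensor_space proj_norm_nonneg tensor_space_add)

text \<open>The easy half of the duality between the projective norm and bounded bilinear forms: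
  evaluate at an almost optimal representation.\<close>

lemma contractive_form_bound:
  assumes t: "t \<in> tensor_space X Y" and bil: "bilinear_on X Y (*) \<phi>"
    and contr: "\<And>x y. x \<in> vecs X \<Longrightarrow> y \<in> vecs Y \<Longrightarrow> norm (\<phi> x y) \<le> nrm X x * nrm Y y"
  shows "norm (t \<phi>) \<le> proj_norm X Y t"
proof (rule field_le_epsilon)
  fix e :: real assume "e > 0"
  obtain n :: nat and x y where 1: "\<forall>i<n. x i \<in> vecs X \<and> y i \<in> vecs Y"
      "t = (\<Sum>i<n. tensor X Y (x i) (y i))"
      "(\<Sum>i<n. nrm X (x i) * nrm Y (y i)) < proj_norm X Y t + e"
    by (rule proj_norm_approx[OF t \<open>e > 0\<close>])
  have "norm (t \<phi>) = norm (\<Sum>i<n. \<phi> (x i) (y i))"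
    using bil by (simp add: 1(2) fun_sum_apply tensor_def)
  also have "\<dots> \<le> (\<Sum>i<n. nrm X (x i) * nrm Y (y i))"
    using 1(1) contr by (intro sum_norm_le) auto
  finally show "norm (t \<phi>) \<le> proj_norm X Y t + e" using 1(3) by simp
qed

text \<open>Turns equality of two series in the completion into an identity of scalars: the partial
  sums differ by a null sequence in the projective norm, which controls a contractive form.\<close>

lemma tens_sums_form:
  assumes "\<And>i. s i \<in> tensor_space X Y" "\<And>i. t i \<in> tensor_space X Y"
    and "tens_sums X Y s z" "tens_sums X Y t z" and bil: "bilinear_on X Y (*) \<phi>"
    and contr: "\<And>x y. x \<in> vecs X \<Longrightarrow> y \<in> vecs Y \<Longrightarrow> norm (\<phi> x y) \<le> nrm X x * nrm Y y"
    and lim: "(\<lambda>i. t i \<phi>) sums l"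
  shows "(\<lambda>i. s i \<phi>) sums l"
proof -
  have null: "(\<lambda>n. proj_norm X Y ((\<Sum>i<n. s i) - (\<Sum>i<n. t i))) \<longlonglongrightarrow> 0"
    using assms by (intro same_limit[of z] sum_mem) (auto simp: tens_sums_def proj_tensor_def)
  have "norm ((\<Sum>i<n. s i \<phi>) - (\<Sum>i<n. t i \<phi>))
      \<le> proj_norm X Y ((\<Sum>i<n. s i) - (\<Sum>i<n. t i))" for n
    using contractive_form_bound[OF diff_mem[OF sum_mem sum_mem] bil contr, of "{..<n}" s "{..<n}" t]
      assms(1,2) by (simp add: fun_sum_apply)
  then have "(\<lambda>n. (\<Sum>i<n. s i \<phi>) - (\<Sum>i<n. t i \<phi>)) \<longlonglongrightarrow> 0"
    by (rule Lim_null_comparison[OF always_eventually, rule_format, OF _ null])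
  from tendsto_add[OF this lim[unfolded sums_def]] show ?thesis by (simp add: sums_def)
qed

text \<open>Absolute summability makes the partial sums Cauchy, and their class is the sum. Its norm
  is the limit of the norms of the partial sums, so a uniform bound passes to it.\<close>

lemma tens_suminf_sums:
  assumes t: "\<And>i. t i \<in> tensor_space X Y" and summ: "summable (\<lambda>i. proj_norm X Y (t i))"
  shows "tens_sums X Y t (tens_suminf X Y t)"
    and "\<And>C. (\<And>n. proj_norm X Y (\<Sum>i<n. t i) \<le> C)
          \<Longrightarrow> completion_norm (proj_norm X Y) (tens_suminf X Y t) \<le> C"
proof -
  let ?V = "tensor_space X Y" and ?N = "proj_norm X Y"
  define S where "S n = (\<Sum>i<n. t i)" for n
  have S_mem: "S n \<in> ?V" for n unfolding S_def using t by (intro sum_mem)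
  have S_diff: "?N (S m - S n) \<le> (\<Sum>i\<in>{n..<m}. ?N (t i))" if "n \<le> m" for m n
  proof -
    have "S m - S n = (\<Sum>i\<in>{n..<m}. t i)"
      unfolding S_def lessThan_atLeast0 using sum_diff_nat_ivl[of 0 n m t] that by simp
    then show ?thesis using N_sum_le[OF t] by simp
  qed
  have "S \<in> cauchy_seqs ?V ?N"
    unfolding cauchy_seqs_def
  proof (intro CollectI conjI allI impI)
    fix e :: real assume "e > 0"
    then obtain M where M: "\<And>m n. m \<ge> M \<Longrightarrow> norm (\<Sum>i\<in>{m..<n}. ?N (t i)) < e"
      using summ unfolding summable_Cauchy by blast
    have *: "?N (S m - S n) < e" if "n \<le> m" "M \<le> n" for m n
      using S_diff[OF that(1)] M[OF that(2), of m] by simp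
    have "?N (S m - S n) < e" if "m \<ge> M" "n \<ge> M" for m n
      using *[of n m] *[of m n] N_commute[OF S_mem S_mem] that by (cases "n \<le> m") auto
    then show "\<exists>M. \<forall>m\<ge>M. \<forall>n\<ge>M. ?N (S m - S n) < e" by blast
  qed (rule S_mem)
  note lim = cauchy_embed_lim[OF this]
  define z where "z = null_rel ?V ?N `` {S}"
  have z: "tens_sums X Y t z"
    using lim(1,3) unfolding tens_sums_def proj_tensor_def z_def by (simp add: S_def)
  have "tens_suminf X Y t = z" unfolding tens_suminf_def
  proof (rule the_equality[where P = "tens_sums X Y t", OF z])
    fix z' assume "tens_sums X Y t z'"
    then show "z' = z"
      using limit_unique[of z' z S] z S_mem unfolding tens_sums_def proj_tensor_def
      by (simp add: S_def)
  qed
  then show "tens_sums X Y t (tens_suminf X Y t)" using z by simp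
  fix C assume "\<And>n. ?N (\<Sum>i<n. t i) \<le> C"
  then show "completion_norm ?N (tens_suminf X Y t) \<le> C"
    unfolding \<open>tens_suminf X Y t = z\<close>
    using lim(1,2) unfolding z_def[symmetric] S_def[symmetric]
    by (intro LIMSEQ_le_const2[OF completion_norm_lim]) auto
qed

end

section \<open>Sequence spaces\<close>

lemma vecs_lp: "x \<in> vecs (lp p) \<longleftrightarrow> summable (\<lambda>n. norm (x n) powr p)"
  and scal_lp: "scal (lp p) c x = (\<lambda>n. c * x n)"
  and nrm_lp: "nrm (lp p) x = (\<Sum>n. norm (x n) powr p) powr (1 / p)"
  by (simp_all add: lp_def)

lemma nrm_lp_nonneg: "0 \<le> nrm (lp p) x"
  by (simp add: nrm_lp)

lemma nrm_lp_powr: "p \<noteq> 0 \<Longrightarrow> x \<in> vecs (lp p) \<Longrightarrow> nrm (lp p) x powr p = (\<Sum>n. norm (x n) powr p)"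
  by (simp add: nrm_lp vecs_lp powr_powr suminf_nonneg)

lemma scal_lp_mem: "x \<in> vecs (lp p) \<Longrightarrow> (\<lambda>n. c * x n) \<in> vecs (lp p)"
  by (simp add: vecs_lp norm_mult powr_mult summable_mult)

lemma nrm_scal_lp:
  assumes "p \<noteq> 0" and "x \<in> vecs (lp p)"
  shows "nrm (lp p) (\<lambda>n. c * x n) = norm c * nrm (lp p) x"
  using assms
  by (simp add: nrm_lp vecs_lp norm_mult powr_mult suminf_mult suminf_nonneg powr_powr)

text \<open>Holds for every real \<open>p\<close> because \<open>0 powr p = 0\<close>.\<close>

lemma finite_support_mem:
  assumes "\<And>n. n \<ge> m \<Longrightarrow> x n = 0"
  shows "x \<in> vecs (lp p)"
  unfolding vecs_lp using assms by (intro summable_finite[of "{..<m}"]) (auto simp: not_less)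

lemma nrm_lp_finite_support:
  assumes "\<And>n. n \<ge> m \<Longrightarrow> x n = 0"
  shows "nrm (lp p) x = (\<Sum>n<m. norm (x n) powr p) powr (1 / p)"
  unfolding nrm_lp using assms by (subst suminf_finite[of "{..<m}"]) (auto simp: not_less)

lemma unit_seq_mem: "unit_seq i \<in> vecs (lp p)"
  by (rule finite_support_mem[of "Suc i"]) (auto simp: unit_seq_def)

lemma norm_le_nrm_lp:
  assumes "p > 0" and "x \<in> vecs (lp p)"
  shows "norm (x n) \<le> nrm (lp p) x"
proof -
  have "norm (x n) powr p \<le> (\<Sum>n. norm (x n) powr p)"
    using sum_le_suminf[of "\<lambda>n. norm (x n) powr p" "{n}"] assms by (simp add: vecs_lp)
  then have "(norm (x n) powr p) powr (1 / p) \<le> nrm (lp p) x"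
    unfolding nrm_lp using assms by (intro powr_mono2) auto
  then show ?thesis using assms by (simp add: powr_powr)
qed

lemma nrm_lp_eq_zero:
  assumes "p > 0" "x \<in> vecs (lp p)" "nrm (lp p) x = 0"
  shows "x n = 0"
  using norm_le_nrm_lp[OF assms(1,2), of n] assms(3) by simp

lemma nspace_pair_lp: "p > 0 \<Longrightarrow> nspace_pair (lp p :: ('k::real_normed_field, _) nspace) (lp q :: ('k, _) nspace)"
  by unfold_locales (auto simp: vecs_lp scal_lp nrm_lp)

lemma bilinear_onD:
  assumes "bilinear_on X Y s B" and "x \<in> vecs X" "y \<in> vecs Y"
  shows "x' \<in> vecs X \<Longrightarrow> B (x + x') y = B x y + B x' y"
    and "y' \<in> vecs Y \<Longrightarrow> B x (y + y') = B x y + B x y'"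
    and "B (scal X c x) y = s c (B x y)" and "B x (scal Y c y) = s c (B x y)"
  using assms unfolding bilinear_on_def by blast+

lemma tscale_tensor:
  assumes "x \<in> vecs X" "y \<in> vecs Y"
  shows "tscale c (tensor X Y x y) = tensor X Y (scal X c x) y"
  using bilinear_onD(3)[OF _ assms, where s = "(*)"] by (auto simp: tscale_def tensor_def)

subsection \<open>Diagonal tensors\<close>

text \<open>A sign pattern is coded by the set \<open>T\<close> of flipped coordinates, so that
  averaging is a sum over \<open>Pow {..<n}\<close>, which splits along
  \<open>insert n\<close>.\<close>

definition sign_seq :: "(nat \<Rightarrow> real) \<Rightarrow> nat \<Rightarrow> nat set \<Rightarrow> nat \<Rightarrow> 'k::real_normed_field" where
  "sign_seq a n T j = (if j < n then of_real (if j \<in> T then - a j else a j) else 0)"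

lemma sign_seq_mem: "sign_seq a n T \<in> vecs (lp p)"
  by (rule finite_support_mem[of n]) (simp add: sign_seq_def)

lemma nrm_sign_seq:
  assumes "\<And>i. 0 \<le> a i"
  shows "nrm (lp p) (sign_seq a n T) = (\<Sum>i<n. a i powr p) powr (1 / p)"
proof -
  have "nrm (lp p) (sign_seq a n T :: nat \<Rightarrow> 'a) = (\<Sum>i<n. norm (sign_seq a n T i :: 'a) powr p) powr (1 / p)"
    by (rule nrm_lp_finite_support) (simp add: sign_seq_def)
  also have "(\<Sum>i<n. norm (sign_seq a n T i :: 'a) powr p) = (\<Sum>i<n. a i powr p)"
    using assms by (intro sum.cong) (auto simp: sign_seq_def)
  finally show ?thesis .
qed

lemma sign_seq_Suc:
  assumes "T \<subseteq> {..<n}"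
  shows "sign_seq a (Suc n) T = sign_seq a n T + scal (lp p) (of_real (a n)) (unit_seq n)"
    and "sign_seq a (Suc n) (insert n T) = sign_seq a n T + scal (lp p) (of_real (- a n)) (unit_seq n)"
  using assms by (auto simp: fun_eq_iff sign_seq_def scal_lp unit_seq_def less_Suc_eq)

text \<open>Averaging over all sign patterns cancels the off-diagonal terms.\<close>

lemma sum_sign_seq:
  fixes B :: "(nat \<Rightarrow> 'k) \<Rightarrow> (nat \<Rightarrow> 'k) \<Rightarrow> 'k::real_normed_field"
  assumes B: "bilinear_on (lp p) (lp q) (*) B"
  shows "(\<Sum>T\<in>Pow {..<n}. B (sign_seq a n T) (sign_seq b n T))
    = 2 ^ n * (\<Sum>i<n. of_real (a i * b i) * B (unit_seq i) (unit_seq i))"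
proof (induction n)
  case 0
  \<comment> \<open>\<open>bilinear_on\<close> has no clause for the zero vector, so it is written
    as a zero multiple of a basis vector.\<close>
  have "sign_seq a 0 {} = scal (lp p) 0 (unit_seq 0 :: nat \<Rightarrow> 'k)"
    by (simp add: fun_eq_iff sign_seq_def scal_lp)
  moreover have "B (scal (lp p) 0 (unit_seq 0)) y = 0 * B (unit_seq 0) y" if "y \<in> vecs (lp q)" for y
    by (rule bilinear_onD(3)[OF B unit_seq_mem that])
  ultimately show ?case by (simp add: sign_seq_mem)
next
  case (Suc n)
  have scal_unit_mem: "scal (lp p') c (unit_seq n) \<in> vecs (lp p')" for p' and c :: 'k
    unfolding scal_lp by (rule scal_lp_mem[OF unit_seq_mem])
  have expand: "B (x + scal (lp p) c (unit_seq n)) (y + scal (lp q) d (unit_seq n))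
      = B x y + d * B x (unit_seq n) + c * B (unit_seq n) y + c * d * B (unit_seq n) (unit_seq n)"
    if "x \<in> vecs (lp p)" "y \<in> vecs (lp q)" "y + scal (lp q) d (unit_seq n) \<in> vecs (lp q)" for x y c d
    using that by (simp add: bilinear_onD[OF B] unit_seq_mem scal_unit_mem algebra_simps)
  \<comment> \<open>\<open>T\<close> and \<open>insert n T\<close> differ in the sign of both new
    coordinates: the mixed terms are odd in that sign and cancel, the term at \<open>(n, n)\<close>
    is even and doubles.\<close>
  have step: "B (sign_seq a (Suc n) T) (sign_seq b (Suc n) T)
      + B (sign_seq a (Suc n) (insert n T)) (sign_seq b (Suc n) (insert n T))
    = 2 * B (sign_seq a n T) (sign_seq b n T) + 2 * (of_real (a n * b n) * B (unit_seq n) (unit_seq n))"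
    if T: "T \<in> Pow {..<n}" for T
  proof -
    have T': "T \<subseteq> {..<n}" using T by simp
    have mem: "sign_seq b n T + scal (lp q) (of_real (b n)) (unit_seq n :: nat \<Rightarrow> 'k) \<in> vecs (lp q)"
      "sign_seq b n T + scal (lp q) (of_real (- b n)) (unit_seq n :: nat \<Rightarrow> 'k) \<in> vecs (lp q)"
      unfolding sign_seq_Suc[OF T', symmetric] by (rule sign_seq_mem)+
    show ?thesis
      unfolding sign_seq_Suc(1)[OF T', of a p] sign_seq_Suc(2)[OF T', of a p]
        sign_seq_Suc(1)[OF T', of b q] sign_seq_Suc(2)[OF T', of b q]
        expand[OF sign_seq_mem sign_seq_mem mem(1)] expand[OF sign_seq_mem sign_seq_mem mem(2)]
      by (simp add: algebra_simps)
  qed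
  have inj: "inj_on (insert n) (Pow {..<n})"
    by (auto simp: inj_on_def insert_eq_iff intro!: insert_ident[THEN iffD1])
  have "Pow {..<Suc n} = Pow {..<n} \<union> insert n ` Pow {..<n}"
    by (simp add: lessThan_Suc Pow_insert)
  then have "(\<Sum>T\<in>Pow {..<Suc n}. B (sign_seq a (Suc n) T) (sign_seq b (Suc n) T))
    = (\<Sum>T\<in>Pow {..<n}. B (sign_seq a (Suc n) T) (sign_seq b (Suc n) T))
      + (\<Sum>T\<in>insert n ` Pow {..<n}. B (sign_seq a (Suc n) T) (sign_seq b (Suc n) T))"
    by (simp, intro sum.union_disjoint) auto
  also have "\<dots> = (\<Sum>T\<in>Pow {..<n}. B (sign_seq a (Suc n) T) (sign_seq b (Suc n) T)
      + B (sign_seq a (Suc n) (insert n T)) (sign_seq b (Suc n) (insert n T)))"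
    using inj by (simp add: sum.reindex sum.distrib)
  also have "\<dots> = (\<Sum>T\<in>Pow {..<n}. 2 * B (sign_seq a n T) (sign_seq b n T)
      + 2 * (of_real (a n * b n) * B (unit_seq n) (unit_seq n)))"
    by (rule sum.cong[OF refl step])
  also have "\<dots> = 2 ^ Suc n * (\<Sum>i<Suc n. of_real (a i * b i) * B (unit_seq i) (unit_seq i))"
    by (simp add: sum.distrib sum_distrib_left[symmetric] Suc.IH card_Pow algebra_simps)
  finally show ?case .
qed

text \<open>All \<open>2 ^ n\<close> sign patterns give rank-one tensors with the same norm product,
  so their average costs no more than one of them.\<close>

lemma proj_norm_diagonal_le:
  fixes a b :: "nat \<Rightarrow> real" and p q :: real
  assumes p: "p > 0" and nonneg: "\<And>i. 0 \<le> a i" "\<And>i. 0 \<le> b i"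
  defines "t \<equiv> (\<lambda>i. tscale (of_real (a i * b i)) (tensor (lp p) (lp q) (unit_seq i) (unit_seq i))
    :: ('k::real_normed_field, nat \<Rightarrow> 'k, nat \<Rightarrow> 'k) tens)"
  shows "proj_norm (lp p) (lp q) (\<Sum>i<n. t i)
    \<le> (\<Sum>i<n. a i powr p) powr (1 / p) * (\<Sum>i<n. b i powr q) powr (1 / q)"
proof -
  interpret nspace_pair "lp p :: ('k, nat \<Rightarrow> 'k) nspace" "lp q :: ('k, nat \<Rightarrow> 'k) nspace"
    using p by (rule nspace_pair_lp)
  let ?x = "\<lambda>T. scal (lp p) (1 / 2 ^ n :: 'k) (sign_seq a n T)"
  let ?y = "\<lambda>T. sign_seq b n T :: nat \<Rightarrow> 'k"
  have mem: "?x T \<in> vecs (lp p) \<and> ?y T \<in> vecs (lp q)" for T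
    unfolding scal_lp by (intro conjI scal_lp_mem sign_seq_mem)
  have eq: "(\<Sum>i<n. t i) = (\<Sum>T\<in>Pow {..<n}. tensor (lp p) (lp q) (?x T) (?y T))"
  proof
    fix B :: "(nat \<Rightarrow> 'k) \<Rightarrow> (nat \<Rightarrow> 'k) \<Rightarrow> 'k"
    show "(\<Sum>i<n. t i) B = (\<Sum>T\<in>Pow {..<n}. tensor (lp p) (lp q) (?x T) (?y T)) B"
    proof (cases "bilinear_on (lp p :: ('k, nat \<Rightarrow> 'k) nspace) (lp q) (*) B")
      case True
      have "B (?x T) (?y T) = 1 / 2 ^ n * B (sign_seq a n T) (?y T)" for T
        by (rule bilinear_onD(3)[OF True sign_seq_mem sign_seq_mem])
      then have "(\<Sum>T\<in>Pow {..<n}. B (?x T) (?y T))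
          = 1 / 2 ^ n * (\<Sum>T\<in>Pow {..<n}. B (sign_seq a n T) (?y T))"
        by (simp add: sum_distrib_left)
      then show ?thesis
        using True by (simp add: fun_sum_apply tensor_def tscale_def t_def sum_sign_seq)
    qed (simp add: fun_sum_apply tensor_def tscale_def t_def)
  qed
  have "nrm (lp p) (?x T) * nrm (lp q) (?y T) = 1 / 2 ^ n *
      ((\<Sum>i<n. a i powr p) powr (1 / p) * (\<Sum>i<n. b i powr q) powr (1 / q))" for T
    using p nonneg unfolding scal_lp
    by (subst nrm_scal_lp) (auto simp: sign_seq_mem nrm_sign_seq norm_divide norm_power)
  then have "(\<Sum>T\<in>Pow {..<n}. nrm (lp p) (?x T) * nrm (lp q) (?y T))
      = (\<Sum>i<n. a i powr p) powr (1 / p) * (\<Sum>i<n. b i powr q) powr (1 / q)"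
    by (simp add: card_Pow)
  then show ?thesis using proj_norm_le[of "Pow {..<n}" ?x ?y] mem unfolding eq by simp
qed

section \<open>Hoelder's inequality with three exponents\<close>

text \<open>The excess \<open>e u\<close> of \<open>u / g - 1\<close> over \<open>ln (u / g)\<close>
  is nonnegative and vanishes only at \<open>u = g\<close>. As \<open>g\<close> is the weighted
  geometric mean, the logarithms cancel in the weighted sum of the excesses. If \<open>a\<close> or
  \<open>b\<close> is 0, then \<open>g = 0\<close> and \<open>\<gamma> * w > 0\<close> makes the
  inequality strict.\<close>

lemma weighted_young:
  fixes a b w \<alpha> \<beta> \<gamma> :: real
  assumes nonneg: "0 \<le> a" "0 \<le> b" and w: "0 < w"
    and exps: "0 < \<alpha>" "0 < \<beta>" "0 < \<gamma>" "\<alpha> + \<beta> + \<gamma> = 1"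
  defines "g \<equiv> w powr \<gamma> * a powr \<alpha> * b powr \<beta>"
  shows "g \<le> \<gamma> * w + \<alpha> * a + \<beta> * b"
    and "g = \<gamma> * w + \<alpha> * a + \<beta> * b \<Longrightarrow> a = w \<and> b = w"
proof -
  let ?R = "\<gamma> * w + \<alpha> * a + \<beta> * b"
  have main: "g \<le> ?R \<and> (g = ?R \<longrightarrow> a = w \<and> b = w)"
  proof (cases "a = 0 \<or> b = 0")
    case True
    then have "g = 0" by (auto simp: g_def)
    moreover have "?R > 0" using assms by (intro add_pos_nonneg) auto
    ultimately show ?thesis by simp
  next
    case False
    then have pos: "a > 0" "b > 0" using nonneg by auto
    then have "g > 0" using w by (simp add: g_def)
    have ln_g: "ln g = \<gamma> * ln w + \<alpha> * ln a + \<beta> * ln b"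
      using pos w by (simp add: g_def ln_mult ln_powr)
    define e where "e u = u / g - 1 - ln (u / g)" for u
    have e_nonneg: "e u \<ge> 0" if "u > 0" for u
      using ln_le_minus_one[of "u / g"] that \<open>g > 0\<close> by (simp add: e_def)
    have e_zero: "u = g" if "u > 0" "e u = 0" for u
      using ln_eq_minus_one[of "u / g"] that \<open>g > 0\<close> by (simp add: e_def)
    have "?R / g - 1 = \<gamma> * e w + \<alpha> * e a + \<beta> * e b"
    proof -
      have "\<gamma> * e w + \<alpha> * e a + \<beta> * e b
          = ?R / g - (\<alpha> + \<beta> + \<gamma>) - (\<gamma> * ln w + \<alpha> * ln a + \<beta> * ln b) + (\<alpha> + \<beta> + \<gamma>) * ln g"
        using pos w \<open>g > 0\<close> by (simp add: e_def ln_div algebra_simps add_divide_distrib)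
      then show ?thesis using exps(4) ln_g by simp
    qed
    moreover have parts: "\<gamma> * e w \<ge> 0" "\<alpha> * e a \<ge> 0" "\<beta> * e b \<ge> 0"
      using exps pos w e_nonneg by auto
    ultimately have diff: "?R / g \<ge> 1" "?R / g = 1 \<Longrightarrow> \<gamma> * e w = 0 \<and> \<alpha> * e a = 0 \<and> \<beta> * e b = 0"
      by linarith+
    have "g \<le> ?R" using diff(1) \<open>g > 0\<close> by (simp add: field_simps)
    moreover have "a = w \<and> b = w" if "g = ?R"
      using diff(2) that \<open>g > 0\<close> exps e_zero[OF w] e_zero[OF pos(1)] e_zero[OF pos(2)] by auto
    ultimately show ?thesis by blast
  qed
  show "g \<le> ?R" using main by simp
  show "g = ?R \<Longrightarrow> a = w \<and> b = w" using main by simp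
qed

text \<open>The majorant \<open>M\<close> of the terms of the Hoelder sum is what makes the equality case termwise.\<close>

lemma hoelder_majorant:
  fixes p q \<gamma> :: real and w :: "nat \<Rightarrow> real" and x y :: "nat \<Rightarrow> 'k::real_normed_field"
  assumes exps: "0 < p" "0 < q" "0 < \<gamma>" "1 / p + 1 / q + \<gamma> = 1"
    and w: "\<And>n. 0 < w n" "w sums 1"
    and x: "x \<in> vecs (lp p)" and y: "y \<in> vecs (lp q)"
  obtains M where "M sums (nrm (lp p) x * nrm (lp q) y)"
    and "\<And>n. w n powr \<gamma> * (norm (x n) * norm (y n)) \<le> M n"
    and "\<And>n. nrm (lp p) x * nrm (lp q) y \<noteq> 0 \<Longrightarrow> w n powr \<gamma> * (norm (x n) * norm (y n)) = M n \<Longrightarrow>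
      norm (x n) = nrm (lp p) x * w n powr (1 / p) \<and> norm (y n) = nrm (lp q) y * w n powr (1 / q)"
proof (cases "nrm (lp p) x * nrm (lp q) y = 0")
  case True
  have "norm (x n) * norm (y n) = 0" for n
    using True nrm_lp_eq_zero[OF exps(1) x] nrm_lp_eq_zero[OF exps(2) y] by auto
  then have "w n powr \<gamma> * (norm (x n) * norm (y n)) \<le> 0" for n
    unfolding \<open>norm (x n) * norm (y n) = 0\<close> by simp
  then show thesis using that[of "\<lambda>_. 0"] True by simp
next
  case False
  define R where "R = nrm (lp p) x"
  define S where "S = nrm (lp q) y"
  have pos: "R > 0" "S > 0"
    using False nrm_lp_nonneg[of p x] nrm_lp_nonneg[of q y] unfolding R_def S_def by auto
  \<comment> \<open>After this normalisation \<open>A\<close>, \<open>B\<close> and \<open>w\<close>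
    all sum to 1, hence so does their weighted mean \<open>Z\<close>, which majorises the
    terms.\<close>
  define A where "A n = norm (x n) powr p / R powr p" for n
  define B where "B n = norm (y n) powr q / S powr q" for n
  have "A sums 1"
    using sums_divide[OF summable_sums[OF x[unfolded vecs_lp]], of "R powr p"] pos exps x
    by (simp add: A_def[abs_def] R_def nrm_lp_powr[symmetric])
  have "B sums 1"
    using sums_divide[OF summable_sums[OF y[unfolded vecs_lp]], of "S powr q"] pos exps y
    by (simp add: B_def[abs_def] S_def nrm_lp_powr[symmetric])
  have xA: "norm (x n) = R * A n powr (1 / p)" for n
    using pos exps by (simp add: A_def powr_divide powr_powr)
  have yB: "norm (y n) = S * B n powr (1 / q)" for n
    using pos exps by (simp add: B_def powr_divide powr_powr)
  define Z where "Z n = \<gamma> * w n + 1 / p * A n + 1 / q * B n" for n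
  have factor: "w n powr \<gamma> * (norm (x n) * norm (y n))
      = (R * S) * (w n powr \<gamma> * A n powr (1 / p) * B n powr (1 / q))" for n
    unfolding xA yB by simp
  have AB: "A n \<ge> 0" "B n \<ge> 0" for n by (simp_all add: A_def B_def)
  have inv: "0 < 1 / p" "0 < 1 / q" using exps by auto
  note young = weighted_young[OF AB(1) AB(2) w(1) inv exps(3,4), of n n n for n, folded Z_def]
  have "Z sums (\<gamma> * 1 + 1 / p * 1 + 1 / q * 1)"
    unfolding Z_def using \<open>A sums 1\<close> \<open>B sums 1\<close> w(2) by (intro sums_add sums_mult)
  then have "Z sums 1" using exps(4) by (simp add: add.commute add.left_commute)
  show thesis
  proof (rule that[of "\<lambda>n. R * S * Z n"])
    show "(\<lambda>n. R * S * Z n) sums (nrm (lp p) x * nrm (lp q) y)"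
      using sums_mult[OF \<open>Z sums 1\<close>, of "R * S"] by (simp add: R_def S_def)
    show "w n powr \<gamma> * (norm (x n) * norm (y n)) \<le> R * S * Z n" for n
      unfolding factor using young(1)[of n] pos by (intro mult_left_mono) auto
    fix n assume "w n powr \<gamma> * (norm (x n) * norm (y n)) = R * S * Z n"
    then have "A n = w n \<and> B n = w n"
      unfolding factor using young(2)[of n] pos by simp
    then show "norm (x n) = nrm (lp p) x * w n powr (1 / p) \<and> norm (y n) = nrm (lp q) y * w n powr (1 / q)"
      using xA[of n] yB[of n] by (simp add: R_def S_def)
  qed
qed

text \<open>When \<open>w\<close> sums to 1, the weights \<open>w n powr \<gamma>\<close> have norm
  1 in the sequence space of exponent \<open>1 / \<gamma>\<close>; for
  \<open>\<gamma> = 1 - 1 / r\<close> this exponent is conjugate to r.\<close>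

definition hoelder_form :: "(nat \<Rightarrow> real) \<Rightarrow> real \<Rightarrow> (nat \<Rightarrow> 'k) \<Rightarrow> (nat \<Rightarrow> 'k) \<Rightarrow> 'k::real_normed_field" where
  "hoelder_form w \<gamma> x y = (\<Sum>n. of_real (w n powr \<gamma>) * (x n * y n))"

context
  fixes p q \<gamma> :: real and w :: "nat \<Rightarrow> real"
  assumes exps: "0 < p" "0 < q" "0 < \<gamma>" "1 / p + 1 / q + \<gamma> = 1"
    and w: "\<And>n. 0 < w n" "w sums 1"
begin

lemma hoelder_form_sums:
  fixes x y :: "nat \<Rightarrow> 'k::{real_normed_field, banach}"
  assumes x: "x \<in> vecs (lp p)" and y: "y \<in> vecs (lp q)"
  shows "(\<lambda>n. of_real (w n powr \<gamma>) * (x n * y n)) sums hoelder_form w \<gamma> x y"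
    and "norm (hoelder_form w \<gamma> x y) \<le> nrm (lp p) x * nrm (lp q) y"
proof -
  obtain M where M: "M sums (nrm (lp p) x * nrm (lp q) y)"
    "\<And>n. w n powr \<gamma> * (norm (x n) * norm (y n)) \<le> M n"
    by (rule hoelder_majorant[OF exps w x y]) (rule that)
  have le: "norm (of_real (w n powr \<gamma>) * (x n * y n)) \<le> M n" for n
    using M(2)[of n] by (simp add: norm_mult)
  have summ: "summable (\<lambda>n. norm (of_real (w n powr \<gamma>) * (x n * y n)))"
    by (rule summable_comparison_test'[OF sums_summable[OF M(1)], of 0]) (use le in simp)
  then show "(\<lambda>n. of_real (w n powr \<gamma>) * (x n * y n)) sums hoelder_form w \<gamma> x y"
    unfolding hoelder_form_def by (rule summable_sums[OF summable_norm_cancel])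
  have "norm (hoelder_form w \<gamma> x y) \<le> (\<Sum>n. norm (of_real (w n powr \<gamma>) * (x n * y n)))"
    unfolding hoelder_form_def by (rule summable_norm[OF summ])
  also have "\<dots> \<le> suminf M" by (rule suminf_le[OF le summ sums_summable[OF M(1)]])
  finally show "norm (hoelder_form w \<gamma> x y) \<le> nrm (lp p) x * nrm (lp q) y"
    using M(1) by (simp add: sums_iff)
qed

lemma hoelder_form_bilinear:
  "bilinear_on (lp p) (lp q) (*)
     (hoelder_form w \<gamma> :: (nat \<Rightarrow> 'k) \<Rightarrow> (nat \<Rightarrow> 'k) \<Rightarrow> 'k::{real_normed_field, banach})"
proof -
  note sm = hoelder_form_sums(1)[where 'k = 'k]
  show ?thesis
    unfolding bilinear_on_def scal_lp
  proof (intro conjI ballI allI)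
    fix x y :: "nat \<Rightarrow> 'k" and c :: 'k
    assume x: "x \<in> vecs (lp p)" and y: "y \<in> vecs (lp q)"
    show "hoelder_form w \<gamma> (\<lambda>n. c * x n) y = c * hoelder_form w \<gamma> x y"
      unfolding hoelder_form_def[of _ _ "\<lambda>n. c * x n"]
      by (rule sums_unique[symmetric]) (use sums_mult[OF sm[OF x y], of c] in \<open>simp add: algebra_simps\<close>)
    show "hoelder_form w \<gamma> x (\<lambda>n. c * y n) = c * hoelder_form w \<gamma> x y"
      unfolding hoelder_form_def[of _ _ _ "\<lambda>n. c * y n"]
      by (rule sums_unique[symmetric]) (use sums_mult[OF sm[OF x y], of c] in \<open>simp add: algebra_simps\<close>)
  next
    fix x x' y :: "nat \<Rightarrow> 'k"
    assume x: "x \<in> vecs (lp p)" "x' \<in> vecs (lp p)" and y: "y \<in> vecs (lp q)"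
    show "hoelder_form w \<gamma> (x + x') y = hoelder_form w \<gamma> x y + hoelder_form w \<gamma> x' y"
      unfolding hoelder_form_def[of _ _ "x + x'"]
      by (rule sums_unique[symmetric])
         (use sums_add[OF sm[OF x(1) y] sm[OF x(2) y]] in \<open>simp add: algebra_simps\<close>)
  next
    fix x y y' :: "nat \<Rightarrow> 'k"
    assume x: "x \<in> vecs (lp p)" and y: "y \<in> vecs (lp q)" "y' \<in> vecs (lp q)"
    show "hoelder_form w \<gamma> x (y + y') = hoelder_form w \<gamma> x y + hoelder_form w \<gamma> x y'"
      unfolding hoelder_form_def[of _ _ _ "y + y'"]
      by (rule sums_unique[symmetric])
         (use sums_add[OF sm[OF x y(1)] sm[OF x y(2)]] in \<open>simp add: algebra_simps\<close>)
  qed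
qed

text \<open>The gaps \<open>M n - w n powr \<gamma> * Re (x n * y n)\<close> are nonnegative with
  sum 0, so each vanishes. Equality of modulus and majorant fixes the moduli, equality of real part
  and modulus fixes the phases.\<close>

lemma hoelder_form_equality:
  fixes x y :: "nat \<Rightarrow> complex"
  assumes x: "x \<in> vecs (lp p)" and y: "y \<in> vecs (lp q)"
    and eq: "Re (hoelder_form w \<gamma> x y) = nrm (lp p) x * nrm (lp q) y"
    and nz: "nrm (lp p) x * nrm (lp q) y \<noteq> 0"
  shows "norm (x n) = nrm (lp p) x * w n powr (1 / p)"
    and "norm (y n) = nrm (lp q) y * w n powr (1 / q)"
    and "x n * y n = of_real (norm (x n) * norm (y n))"
proof -
  obtain M where M: "M sums (nrm (lp p) x * nrm (lp q) y)"
    "\<And>n. w n powr \<gamma> * (norm (x n) * norm (y n)) \<le> M n"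
    "\<And>n. nrm (lp p) x * nrm (lp q) y \<noteq> 0 \<Longrightarrow> w n powr \<gamma> * (norm (x n) * norm (y n)) = M n \<Longrightarrow>
      norm (x n) = nrm (lp p) x * w n powr (1 / p) \<and> norm (y n) = nrm (lp q) y * w n powr (1 / q)"
    by (rule hoelder_majorant[OF exps w x y]) (rule that)
  have "(\<lambda>n. Re (of_real (w n powr \<gamma>) * (x n * y n))) sums Re (hoelder_form w \<gamma> x y)"
    by (rule sums_Re[OF hoelder_form_sums(1)[OF x y]])
  then have "(\<lambda>n. w n powr \<gamma> * Re (x n * y n)) sums (nrm (lp p) x * nrm (lp q) y)"
    unfolding eq by simp
  from sums_diff[OF M(1) this]
  have sums0: "(\<lambda>n. M n - w n powr \<gamma> * Re (x n * y n)) sums 0" by simp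
  have Re_le: "w n powr \<gamma> * Re (x n * y n) \<le> w n powr \<gamma> * (norm (x n) * norm (y n))" for n
    using complex_Re_le_cmod[of "x n * y n"] by (intro mult_left_mono) (auto simp: norm_mult)
  have nonneg: "0 \<le> M n - w n powr \<gamma> * Re (x n * y n)" for n
    using M(2)[of n] Re_le[of n] by linarith
  have "M n - w n powr \<gamma> * Re (x n * y n) = 0"
    using suminf_eq_zero_iff[OF sums_summable[OF sums0] nonneg] sums_unique[OF sums0] by metis
  then have M_eq: "w n powr \<gamma> * (norm (x n) * norm (y n)) = M n"
    and Re_eq: "w n powr \<gamma> * Re (x n * y n) = w n powr \<gamma> * (norm (x n) * norm (y n))"
    using M(2)[of n] Re_le[of n] by linarith+
  show "norm (x n) = nrm (lp p) x * w n powr (1 / p)"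
    and "norm (y n) = nrm (lp q) y * w n powr (1 / q)"
    using M(3)[OF nz M_eq] by auto
  have "w n powr \<gamma> > 0" using w(1)[of n] by simp
  with Re_eq have Re: "Re (x n * y n) = cmod (x n * y n)" by (simp add: norm_mult)
  then have "Im (x n * y n) = 0" using cmod_power2[of "x n * y n"] by simp
  then show "x n * y n = of_real (norm (x n) * norm (y n))"
    using Re unfolding norm_mult by (intro complex_eqI) (simp_all only: Re_complex_of_real Im_complex_of_real)
qed

end

section \<open>Non-attainment\<close>

text \<open>
  Bessel's inequality in disguise: weighting the index \<open>i\<close> by \<open>u i n * v i n\<close>, the sequences
  \<open>i \<mapsto> u i n\<close> are orthonormal as \<open>n\<close> varies, yet all have the same modulus at the atom \<open>j\<close>.
\<close>

lemma no_unimodular_orthonormal_atom: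
  fixes u v :: "nat \<Rightarrow> nat \<Rightarrow> complex"
  assumes conj: "\<And>i. (\<forall>n. u i n = 0) \<or> (\<exists>\<kappa>\<ge>0. \<forall>n. v i n = of_real \<kappa> * cnj (u i n))"
    and orth: "\<And>n m. (\<lambda>i. u i n * v i m) sums (if n = m then 1 else 0)"
    and atom: "\<And>n. u j n * v j n = of_real l" and "l > 0"
  shows False
proof -
  have nz: "\<not> (\<forall>n. u j n = 0)" using atom[of 0] \<open>l > 0\<close> by (intro notI) auto
  obtain \<kappa> where \<kappa>: "\<kappa> \<ge> 0" "\<And>n. v j n = of_real \<kappa> * cnj (u j n)" using conj[of j] nz by blast
  have bound: "real K * l \<le> 1" for K
  proof (cases "K = 0")
    case False
    \<comment> \<open>Up to a nonnegative factor, \<open>T i\<close> is the squared modulus of the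
      inner product of the first \<open>K\<close> entries of \<open>u i\<close> and
      \<open>u j\<close>. Orthogonality makes the total \<open>K * l\<close>, while
      \<open>i = j\<close> alone contributes \<open>(K * l) ^ 2\<close>.\<close>
    define T where "T i = (\<Sum>n<K. u i n * v j n) * (\<Sum>m<K. v i m * u j m)" for i
    have "T = (\<lambda>i. \<Sum>n<K. \<Sum>m<K. (v j n * u j m) * (u i n * v i m))"
      by (simp add: T_def fun_eq_iff sum_product algebra_simps)
    moreover have "(\<lambda>i. \<Sum>n<K. \<Sum>m<K. (v j n * u j m) * (u i n * v i m)) sums
        (\<Sum>n<K. \<Sum>m<K. (v j n * u j m) * (if n = m then 1 else 0))"
      by (intro sums_sum sums_mult orth)
    moreover have "(\<Sum>n<K. \<Sum>m<K. (v j n * u j m) * (if n = m then 1 else 0)) = of_real (K * l)"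
      using atom by (simp add: if_distrib mult.commute cong: if_cong)
    ultimately have "T sums of_real (K * l)" by simp
    from sums_Re[OF this] have sums: "(\<lambda>i. Re (T i)) sums (K * l)" by simp
    have nonneg: "Re (T i) \<ge> 0" for i
      using conj[of i]
    proof
      assume "\<exists>\<mu>\<ge>0. \<forall>n. v i n = of_real \<mu> * cnj (u i n)"
      then obtain \<mu> where \<mu>: "\<mu> \<ge> 0" "\<And>n. v i n = of_real \<mu> * cnj (u i n)" by blast
      define s where "s = (\<Sum>n<K. u i n * cnj (u j n))"
      have "(\<Sum>n<K. u i n * v j n) = of_real \<kappa> * s"
        by (simp add: s_def \<kappa>(2) sum_distrib_left algebra_simps)
      moreover have "(\<Sum>m<K. v i m * u j m) = of_real \<mu> * cnj s"
        by (simp add: s_def \<mu>(2) sum_distrib_left algebra_simps)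
      ultimately have "T i = of_real (\<kappa> * \<mu>) * (s * cnj s)" by (simp add: T_def)
      also have "\<dots> = of_real (\<kappa> * \<mu> * (cmod s)\<^sup>2)" by (simp only: complex_norm_square of_real_mult)
      finally show ?thesis using \<kappa>(1) \<mu>(1) by simp
    qed (simp add: T_def)
    have "T j = of_real ((K * l)\<^sup>2)" using atom by (simp add: T_def mult.commute power2_eq_square)
    then have "(K * l)\<^sup>2 = Re (T j)" by simp
    also have "\<dots> \<le> K * l"
      using sum_le_suminf[OF sums_summable[OF sums], of "{j}"] nonneg sums_unique[OF sums] by simp
    finally show ?thesis using False \<open>l > 0\<close> by (simp add: power2_eq_square)
  qed simp
  obtain K where "1 / l < real K" using reals_Archimedean2 by blast
  then show False using bound[of K] \<open>l > 0\<close> by (simp add: field_simps)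
qed

lemma coordinate_form_bilinear:
  "bilinear_on (lp p) (lp q) (*) (\<lambda>x y. x n * y m :: 'k::real_normed_field)"
  by (simp add: bilinear_on_def scal_lp algebra_simps)

lemma isometric_hom_lp:
  assumes "\<And>a. norm (h a) = norm a"
  shows "(\<lambda>n. h (x n)) \<in> vecs (lp p) \<longleftrightarrow> x \<in> vecs (lp p)"
    and "nrm (lp p) (\<lambda>n. h (x n)) = nrm (lp p) x"
  using assms by (simp_all add: vecs_lp nrm_lp)

lemma dyadic_weights_sums: "(\<lambda>n. 2 powr - real (Suc n)) sums 1"
proof -
  have "(\<lambda>n. 2 powr - real (Suc n)) = (\<lambda>n. (1 / 2 :: real) ^ Suc n)"
    unfolding powr_minus powr_realpow[OF zero_less_numeral] by (simp add: power_one_over field_simps)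
  then show ?thesis using power_half_series by simp
qed

text \<open>The isometric embedding \<open>h\<close> treats the real and the complex scalars at once.\<close>

lemma zterm_sum_not_attaining:
  fixes p q r :: real and h :: "'k::{real_normed_field, banach} \<Rightarrow> complex"
  assumes pq: "1 < p" "1 < q" "1 / p + 1 / q < 1" and r: "r = p * q / (p + q)"
    and h: "bounded_linear h" "\<And>a b. h (a * b) = h a * h b" "\<And>a. norm (h a) = norm a"
  defines "X \<equiv> (lp p :: ('k, nat \<Rightarrow> 'k) nspace)" and "Y \<equiv> (lp q :: ('k, nat \<Rightarrow> 'k) nspace)"
  defines "z \<equiv> tens_suminf X Y (zterm p q r)"
  shows "tens_sums X Y (zterm p q r) z" and "z \<in> proj_tensor X Y"
    and "\<not> attains_proj_norm X Y z"
proof -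
  interpret h: bounded_linear h by (rule h(1))
  interpret nspace_pair X Y
    unfolding X_def Y_def using pq by (intro nspace_pair_lp) simp
  have "norm (h 1) = 1" by (simp add: h(3))
  \<comment> \<open>A multiplicative map sends 1 to an idempotent, and isometry excludes 0.\<close>
  then have h1: "h 1 = 1" using h(2)[of 1 1] by auto
  have h_of_real: "h (of_real c) = of_real c" for c
    using h.scaleR[of c 1] by (simp add: h1 of_real_def)

  \<comment> \<open>With the shifted index the weights sum to exactly 1, and the coefficient in
    \<open>zterm\<close> is \<open>w i powr (1 / r)\<close>.\<close>
  define w where "w n = 2 powr - real (Suc n)" for n
  define \<gamma> where "\<gamma> = 1 - 1 / p - 1 / q"
  have exps: "0 < p" "0 < q" "0 < \<gamma>" "1 / p + 1 / q + \<gamma> = 1"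
    using pq by (auto simp: \<gamma>_def)
  have w: "\<And>n. 0 < w n" "w sums 1"
    using dyadic_weights_sums by (auto simp: w_def[abs_def])
  have inv_r: "1 / r = 1 / p + 1 / q" unfolding r using pq by (simp add: field_simps)
  have w_split: "2 powr (- real (Suc i) / r) = w i powr (1 / p) * w i powr (1 / q)" for i
  proof -
    have "- real (Suc i) / r = - real (Suc i) * (1 / p) + - real (Suc i) * (1 / q)"
      using inv_r by (metis distrib_left times_divide_eq_right mult.right_neutral)
    then show ?thesis by (simp only: w_def powr_powr powr_add)
  qed
  have w_full: "w i powr (1 / p) * w i powr (1 / q) * w i powr \<gamma> = w i" for i
    using w(1)[of i] exps(4) by (simp add: powr_add[symmetric])

  \<comment> \<open>Convergence of the series defining \<open>z\<close>\<close>
  let ?t = "\<lambda>i. zterm p q r i :: ('k, nat \<Rightarrow> 'k, nat \<Rightarrow> 'k) tens"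
  have t_eq: "?t i = tscale (of_real (w i powr (1 / p) * w i powr (1 / q))) (tensor X Y (unit_seq i) (unit_seq i))" for i
    by (simp only: zterm_def w_split X_def Y_def)
  have t_form: "?t i \<phi> = of_real (w i powr (1 / p) * w i powr (1 / q)) * \<phi> (unit_seq i) (unit_seq i)"
    if "bilinear_on X Y (*) \<phi>" for i \<phi>
    using that by (simp add: t_eq tscale_def tensor_def)
  \<comment> \<open>Absorbing the coefficient into the first factor makes each term an elementary
    tensor.\<close>
  let ?e = "\<lambda>i. scal X (of_real (w i powr (1 / p) * w i powr (1 / q))) (unit_seq i) :: nat \<Rightarrow> 'k"
  have e_mem: "?e i \<in> vecs X \<and> unit_seq i \<in> vecs Y" for i
    unfolding X_def Y_def scal_lp by (intro conjI scal_lp_mem unit_seq_mem)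
  have t_tensor: "?t i = tensor X Y (?e i) (unit_seq i)" for i
    unfolding t_eq by (rule tscale_tensor) (simp_all add: X_def Y_def unit_seq_mem)
  have t_mem: "?t i \<in> tensor_space X Y" for i
    using sum_tensor_mem[of "{i}" ?e unit_seq] e_mem by (simp add: t_tensor)
  have summ: "summable (\<lambda>i. proj_norm X Y (?t i))"
  proof (rule summable_comparison_test'[of _ 0])
    have "(2::real) powr - (1 / r) < 1"
      using inv_r add_pos_pos[of "1 / p" "1 / q"] exps(1,2) by (intro powr_less_one) auto
    then have "summable (\<lambda>i. (2 powr - (1 / r)) ^ Suc i :: real)"
      by (subst summable_Suc_iff) (simp add: summable_geometric)
    moreover have "(2 powr - (1 / r)) ^ Suc i = (2::real) powr (- real (Suc i) / r)" for i
    proof -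
      have "real (Suc i) * - (1 / r) = - real (Suc i) / r"
        by (simp only: mult_minus_right times_divide_eq_right mult_1_right minus_divide_left)
      moreover have "(2 powr - (1 / r)) ^ Suc i = (2::real) powr (real (Suc i) * - (1 / r))"
        by (rule powr_power) simp
      ultimately show ?thesis by (simp only:)
    qed
    ultimately show "summable (\<lambda>i. 2 powr (- real (Suc i) / r) :: real)" by (simp only:)
    have nrm_unit: "nrm (lp s) (unit_seq i :: nat \<Rightarrow> 'k) = 1" for s i
    proof -
      have "(\<lambda>n. norm (unit_seq i n :: 'k) powr s) = (\<lambda>n. if n = i then 1 else 0)"
        by (simp add: unit_seq_def fun_eq_iff)
      then have "(\<lambda>n. norm (unit_seq i n :: 'k) powr s) sums 1"
        using sums_single[of i "\<lambda>_. 1 :: real"] by simp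
      then show ?thesis by (simp add: nrm_lp sums_iff)
    qed
    fix i
    have "nrm X (?e i) = 2 powr (- real (Suc i) / r)"
      unfolding X_def scal_lp w_split using exps(1)
      by (subst nrm_scal_lp) (simp_all add: unit_seq_mem nrm_unit norm_mult)
    then have "proj_norm X Y (?t i) \<le> 2 powr (- real (Suc i) / r)"
      using proj_norm_le[of "{i}" ?e unit_seq] e_mem by (simp add: t_tensor Y_def nrm_unit)
    then show "norm (proj_norm X Y (?t i)) \<le> 2 powr (- real (Suc i) / r)"
      using proj_norm_nonneg[OF t_mem] by simp
  qed
  note lim = tens_suminf_sums[OF t_mem summ, folded z_def]
  show z: "tens_sums X Y ?t z" by (rule lim(1))
  then show "z \<in> proj_tensor X Y" by (simp add: tens_sums_def)

  \<comment> \<open>With the coefficient split as \<open>w i powr (1 / p)\<close> times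
    \<open>w i powr (1 / q)\<close>, both factors of the sign-averaging bound are powers of a
    partial sum of \<open>w\<close>.\<close>
  have "proj_norm X Y (\<Sum>i<n. ?t i) \<le> 1" for n
  proof -
    have partial: "(\<Sum>i<n. w i) \<le> 1"
      using sum_le_suminf[OF sums_summable[OF w(2)], of "{..<n}"] w by (simp add: sums_iff less_imp_le)
    have "proj_norm X Y (\<Sum>i<n. ?t i)
        \<le> (\<Sum>i<n. (w i powr (1 / p)) powr p) powr (1 / p) * (\<Sum>i<n. (w i powr (1 / q)) powr q) powr (1 / q)"
      unfolding t_eq X_def Y_def using exps(1) by (rule proj_norm_diagonal_le) simp_all
    also have "\<dots> = (\<Sum>i<n. w i) powr (1 / p) * (\<Sum>i<n. w i) powr (1 / q)"
      using exps w(1) by (simp add: powr_powr less_imp_le)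
    also have "\<dots> \<le> 1 * 1"
    proof -
      have "(\<Sum>i<n. w i) powr a \<le> 1" if "a > 0" for a
        using powr_mono2[of a "\<Sum>i<n. w i" 1] partial w(1) that by (simp add: sum_nonneg less_imp_le)
      then show ?thesis using exps(1,2) by (intro mult_mono) auto
    qed
    finally show ?thesis by simp
  qed
  note norm_le = lim(2)[OF this]

  show "\<not> attains_proj_norm X Y z"
  proof
    assume "attains_proj_norm X Y z"
    then obtain x y where xy: "\<And>i. x i \<in> vecs X \<and> y i \<in> vecs Y"
      and sums: "tens_sums X Y (\<lambda>i. tensor X Y (x i) (y i)) z"
      and nrm_sums: "(\<lambda>i. nrm X (x i) * nrm Y (y i)) sums completion_norm (proj_norm X Y) z"
      unfolding attains_proj_norm_def by blast
    have x: "x i \<in> vecs (lp p)" and y: "y i \<in> vecs (lp q)" for i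
      using xy by (simp_all add: X_def Y_def)
    have mem: "tensor X Y (x i) (y i) \<in> tensor_space X Y" for i
      using sum_tensor_mem[of "{i}" x y] xy by simp
    have form: "(\<lambda>i. \<phi> (x i) (y i)) sums l"
      if "bilinear_on X Y (*) \<phi>"
        and "\<And>x y. x \<in> vecs X \<Longrightarrow> y \<in> vecs Y \<Longrightarrow> norm (\<phi> x y) \<le> nrm X x * nrm Y y"
        and "(\<lambda>i. of_real (w i powr (1 / p) * w i powr (1 / q)) * \<phi> (unit_seq i) (unit_seq i)) sums l" for \<phi> l
      using tens_sums_form[OF mem t_mem sums z that(1,2), of l] that(1,3)
      by (simp add: t_form) (simp add: tensor_def)

    \<comment> \<open>Tested against coordinate forms, the assumed representation reproduces the
      diagonal matrix of coefficients of \<open>z\<close>.\<close>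
    have coord: "(\<lambda>i. x i n * y i m) sums (if n = m then of_real (w n powr (1 / p) * w n powr (1 / q)) else 0)" for n m
    proof (rule form)
      show "bilinear_on X Y (*) (\<lambda>x y. x n * y m)"
        unfolding X_def Y_def by (rule coordinate_form_bilinear)
      show "norm (x n * y m) \<le> nrm X x * nrm Y y" if "x \<in> vecs X" "y \<in> vecs Y" for x y
        using that exps unfolding X_def Y_def norm_mult
        by (intro mult_mono norm_le_nrm_lp nrm_lp_nonneg) auto
      have "(\<lambda>i. of_real (w i powr (1 / p) * w i powr (1 / q)) * (unit_seq i n * unit_seq i m :: 'k))
        = (\<lambda>i. if i = n then if n = m then of_real (w i powr (1 / p) * w i powr (1 / q)) else 0 else 0)"
        by (auto simp: unit_seq_def fun_eq_iff)
      then show "(\<lambda>i. of_real (w i powr (1 / p) * w i powr (1 / q)) * (unit_seq i n * unit_seq i m :: 'k))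
          sums (if n = m then of_real (w n powr (1 / p) * w n powr (1 / q)) else 0)"
        by (simp only:) (rule sums_single)
    qed

    have unit_form: "hoelder_form w \<gamma> (unit_seq i) (unit_seq i) = (of_real (w i powr \<gamma>) :: 'k)" for i
    proof -
      have "(\<lambda>n. of_real (w n powr \<gamma>) * (unit_seq i n * unit_seq i n :: 'k)) = (\<lambda>n. if n = i then of_real (w n powr \<gamma>) else 0)"
        by (auto simp: unit_seq_def fun_eq_iff)
      then show ?thesis
        unfolding hoelder_form_def by (simp only:) (rule sums_unique[symmetric, OF sums_single])
    qed
    \<comment> \<open>By \<open>w_full\<close> the form takes the value \<open>w i\<close> at the
      \<open>i\<close>-th term of the defining series.\<close>
    have "(\<lambda>i. hoelder_form w \<gamma> (x i) (y i)) sums 1"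
    proof (rule form)
      show "bilinear_on X Y (*) (hoelder_form w \<gamma>)"
        unfolding X_def Y_def by (rule hoelder_form_bilinear[OF exps w])
      show "norm (hoelder_form w \<gamma> x y) \<le> nrm X x * nrm Y y" if "x \<in> vecs X" "y \<in> vecs Y" for x y :: "nat \<Rightarrow> 'k"
        using that unfolding X_def Y_def by (rule hoelder_form_sums(2)[OF exps w])
      show "(\<lambda>i. of_real (w i powr (1 / p) * w i powr (1 / q)) * hoelder_form w \<gamma> (unit_seq i) (unit_seq i)) sums (1 :: 'k)"
        using sums_of_real[OF w(2), where 'a = 'k]
        by (simp only: unit_form of_real_mult[symmetric] w_full of_real_1)
    qed
    from h.sums[OF this]
    have h_sums: "(\<lambda>i. h (hoelder_form w \<gamma> (x i) (y i))) sums 1" by (simp add: h1)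

    \<comment> \<open>Complex coordinates and extremality of every term\<close>
    define hx where "hx i n = h (x i n)" for i n
    define hy where "hy i n = h (y i n)" for i n
    define R where "R i = nrm (lp p) (hx i)" for i
    define S where "S i = nrm (lp q) (hy i)" for i
    have hx: "hx i \<in> vecs (lp p)" and hy: "hy i \<in> vecs (lp q)"
      and R: "nrm X (x i) = R i" and S: "nrm Y (y i) = S i" for i
      using x y by (simp_all add: isometric_hom_lp[OF h(3)] hx_def[abs_def] hy_def[abs_def] R_def S_def X_def Y_def)
    have h_form: "h (hoelder_form w \<gamma> (x i) (y i)) = hoelder_form w \<gamma> (hx i) (hy i)" for i
      using h.sums[OF hoelder_form_sums(1)[OF exps w x y, of i i]]
      unfolding hoelder_form_def[of w \<gamma> "hx i"]
      by (simp add: h(2) h_of_real hx_def hy_def sums_iff)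
    have Re_sums: "(\<lambda>i. Re (hoelder_form w \<gamma> (hx i) (hy i))) sums 1"
      using sums_Re[OF h_sums] by (simp add: h_form)
    have RS_sums: "(\<lambda>i. R i * S i) sums completion_norm (proj_norm X Y) z"
      using nrm_sums by (simp add: R S)
    have Re_le: "Re (hoelder_form w \<gamma> (hx i) (hy i)) \<le> R i * S i" for i
      using complex_Re_le_cmod hoelder_form_sums(2)[OF exps w hx hy, of i i]
      unfolding R_def S_def by (rule order_trans)
    have "(\<lambda>i. R i * S i - Re (hoelder_form w \<gamma> (hx i) (hy i))) sums
        (completion_norm (proj_norm X Y) z - 1)" by (rule sums_diff[OF RS_sums Re_sums])
    \<comment> \<open>The form bounds the norm of \<open>z\<close> from below by 1 and sign
      averaging bounds it from above, so the nonnegative gaps sum to 0.\<close>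
    moreover have "completion_norm (proj_norm X Y) z \<ge> 1"
      by (rule sums_le[OF Re_le Re_sums RS_sums])
    ultimately have gap: "(\<lambda>i. R i * S i - Re (hoelder_form w \<gamma> (hx i) (hy i))) sums 0"
      and norm_z: "completion_norm (proj_norm X Y) z = 1"
      using norm_le by simp_all
    have eq: "Re (hoelder_form w \<gamma> (hx i) (hy i)) = R i * S i" for i
      using suminf_eq_zero_iff[OF sums_summable[OF gap]] sums_unique[OF gap, symmetric] Re_le by simp
    \<comment> \<open>The norm products sum to 1, so one of them is nonzero; its index serves as the
      atom.\<close>
    have "\<not> (\<forall>i. R i * S i = 0)"
    proof
      assume "\<forall>i. R i * S i = 0"
      then have "(\<lambda>i. 0 :: real) sums 1" using RS_sums unfolding norm_z by (simp only:)
      then show False using sums_unique2[OF sums_zero] by fastforce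
    qed
    then obtain j where j: "R j * S j \<noteq> 0" by blast
    note extremal = hoelder_form_equality[OF exps w hx hy eq[unfolded R_def S_def], folded R_def S_def]

    \<comment> \<open>The rescaling removes the extremal profile: for nondegenerate terms the
      modulus of \<open>u i n\<close> does not depend on \<open>n\<close>.\<close>
    define u where "u i n = hx i n / of_real (w n powr (1 / p))" for i n
    define v where "v i n = hy i n / of_real (w n powr (1 / q))" for i n
    have wpos: "w n powr s > 0" for n s using w(1)[of n] by simp
    have norm_u: "cmod (u i n) = R i" and uv: "u i n * v i n = of_real (R i * S i)"
      if "R i * S i \<noteq> 0" for i n
    proof -
      note ex = extremal[OF that, of n]
      show "cmod (u i n) = R i"
        using ex(1) wpos[of n "1 / p"] by (simp add: u_def norm_divide)
      have "u i n * v i n = of_real (cmod (hx i n) * cmod (hy i n) / (w n powr (1 / p) * w n powr (1 / q)))"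
        using ex(3) by (simp add: u_def v_def)
      also have "cmod (hx i n) * cmod (hy i n) / (w n powr (1 / p) * w n powr (1 / q)) = R i * S i"
        using ex(1,2) wpos[of n "1 / p"] wpos[of n "1 / q"] by simp
      finally show "u i n * v i n = of_real (R i * S i)" .
    qed
    show False
    proof (rule no_unimodular_orthonormal_atom[of u v j "R j * S j"])
      show "u j n * v j n = of_real (R j * S j)" for n by (rule uv[OF j])
      show "0 < R j * S j"
        using j nrm_lp_nonneg[of p "hx j"] nrm_lp_nonneg[of q "hy j"] unfolding R_def S_def
        by (simp add: less_le)
      show "(\<lambda>i. u i n * v i m) sums (if n = m then 1 else 0)" for n m
      proof -
        have "(\<lambda>i. hx i n * hy i m) sums (if n = m then of_real (w n powr (1 / p) * w n powr (1 / q)) else 0)"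
          using h.sums[OF coord[of n m]]
          by (simp add: h(2) h_of_real hx_def hy_def if_distrib h.zero cong: if_cong)
        from sums_divide[OF this, of "of_real (w n powr (1 / p) * w m powr (1 / q))"]
        show ?thesis
          using wpos[of n "1 / p"] wpos[of n "1 / q"]
          by (cases "n = m") (simp_all add: u_def v_def)
      qed
      show "(\<forall>n. u i n = 0) \<or> (\<exists>\<kappa>\<ge>0. \<forall>n. v i n = of_real \<kappa> * cnj (u i n))" for i
      proof (cases "R i * S i = 0")
        \<comment> \<open>A degenerate term has \<open>u i = 0\<close> or \<open>v i = 0\<close>; in
          the second case the factor 0 works.\<close>
        case True
        then consider "R i = 0" | "S i = 0" by auto
        then show ?thesis
        proof cases
          case 1
          then have "u i n = 0" for n
            using nrm_lp_eq_zero[OF exps(1) hx, of i n] by (simp add: R_def u_def)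
          then show ?thesis by simp
        next
          case 2
          then have "v i n = of_real 0 * cnj (u i n)" for n
            using nrm_lp_eq_zero[OF exps(2) hy, of i n] by (simp add: S_def v_def)
          then show ?thesis by blast
        qed
      next
        case False
        \<comment> \<open>The factor is forced by \<open>cmod (u i n) = R i\<close> and
          \<open>u i n * v i n = of_real (R i * S i)\<close>.\<close>
        have "v i n = of_real (S i / R i) * cnj (u i n)" for n
        proof -
          have "u i n \<noteq> 0" using norm_u[OF False, of n] False by auto
          have "u i n * (of_real (S i / R i) * cnj (u i n)) = of_real (S i / R i) * of_real ((cmod (u i n))\<^sup>2)"
            by (simp add: complex_mult_cnj cmod_power2 mult.left_commute)
          also have "\<dots> = of_real (R i * S i)"
            using False by (simp add: norm_u[OF False] power2_eq_square)
          also have "\<dots> = u i n * v i n" by (rule uv[OF False, symmetric])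
          finally show ?thesis
            unfolding mult_cancel_left using \<open>u i n \<noteq> 0\<close> by (simp only: simp_thms)
        qed
        moreover have "S i / R i \<ge> 0" by (simp add: R_def S_def nrm_lp_nonneg)
        ultimately show ?thesis by blast
      qed
    qed
  qed
qed

theorem mainTheorem4:
  fixes p q r :: real
  assumes "1 < p" and "1 < q" and "1 / p + 1 / q < 1"
    and "r = p * q / (p + q)"
  shows "1 < r \<and>
    (let X = (lp p :: (real, nat \<Rightarrow> real) nspace);
         Y = (lp q :: (real, nat \<Rightarrow> real) nspace);
         z = tens_suminf X Y (zterm p q r)
     in tens_sums X Y (zterm p q r) z \<and> z \<in> proj_tensor X Y \<and>
        \<not> attains_proj_norm X Y z \<and> NA X Y \<noteq> proj_tensor X Y) \<and>
    (let X = (lp p :: (complex, nat \<Rightarrow> complex) nspace);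
         Y = (lp q :: (complex, nat \<Rightarrow> complex) nspace);
         z = tens_suminf X Y (zterm p q r)
     in tens_sums X Y (zterm p q r) z \<and> z \<in> proj_tensor X Y \<and>
        \<not> attains_proj_norm X Y z \<and> NA X Y \<noteq> proj_tensor X Y)"
proof -
  have "1 < r" unfolding assms(4) using assms(1-3) by (simp add: field_simps)
  \<comment> \<open>\<open>h\<close> is the inclusion of the reals for real scalars and the identity
    for complex ones; multiplicativity and isometry of \<open>h\<close> remain as premises for
    \<open>auto\<close>. The element \<open>z\<close> itself separates \<open>NA X Y\<close> from
    \<open>proj_tensor X Y\<close>.\<close>
  moreover note zterm_sum_not_attaining[OF assms bounded_linear_of_real]
    zterm_sum_not_attaining[OF assms bounded_linear_ident]
  ultimately show ?thesis unfolding Let_def NA_def by auto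
qed

end
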